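(* Let $\mathfrak O$ be a compact discrete valuation ring with residue field of cardinality $q$. Let $d,e\ge1$, let $\mathcal A$ be a partial colouring of $[d]\times[e]$, and let $u\in \mathrm M_{d\times e}(\mathfrak O)$ have unit entries. If $\mathcal A$ is admissible, then $$\mathsf Z^{\mathsf{ask}}_{\mathrm{SRel}_{d\times e}(\mathcal A,u,\mathfrak O)}(T)=\frac{1-q^{-d-e}T}{(1-T)^2}.$$
   Context: All rings are commutative and unital. $\mathfrak O$ has maximal ideal $\mathfrak P$. Write $[d]=\{1,\dots,d\}$. Ask zeta functions. For a module $A\subset \mathrm M_{d\times e}(S)$ of matrices over a finite ring $S$, let $\mathrm{ask}(A)=\frac1{|A|}\sum_{a\in A}|\mathrm{Ker}(a)|$, where $d\times e$ matrices act by right multiplication on row vectors, i.e. $\mathrm{Ker}(a)=\{x\in S^d: xa=0\}$. For a submodule $M\subset \mathrm M_{d\times e}(\mathfrak O)$, let $M_n$ be its image in $\mathrm M_{d\times e}(\mathfrak O/\mathfrak P^n)$ and $\mathsf Z^{\mathsf{ask}}_M(T)=\sum_{n=0}^\infty \mathrm{ask}(M_n)T^n\in\mathbf Q[[T]]$. Partial colourings. Let $\mathcal C$ be a set (of colours). A partial colouring of $[d]\times[e]$ is a family $\mathcal A=(A_c)_{c\in\mathcal C}$ of pairwise disjoint (possibly empty) subsets of $[d]\times[e]$. A cell $(i,j)\in [d]\times[e]$ is blank if it belongs to no $A_c$. A subgrid is a set $G=I\times J$ with $I\subset[d]$, $J\subset[e]$; it is colour-closed if $A_c\subset G$ for every $c\in\mathcal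 C$ with $A_c\cap G\ne\emptyset$. $\mathcal A$ is admissible if every non-empty colour-closed subgrid of $[d]\times[e]$ contains a blank cell. Relation modules. $\mathrm{Rel}_{d\times e}(\mathcal A,u,\mathfrak O)=\{[x_{ij}]\in \mathrm M_{d\times e}(\mathfrak O): \sum_{(i,j)\in A_c}u_{ij}x_{ij}=0 \text{ for all } c\in\mathcal C\}$ and $\mathrm{SRel}_{d\times e}(\mathcal A,u,\mathfrak O)=\left\{\begin{bmatrix} a & x \\ {x^\top} & b \end{bmatrix}: a\in\mathrm{Sym}_d(\mathfrak O), b\in\mathrm{Sym}_e(\mathfrak O), x\in\mathrm{Rel}_{d\times e}(\mathcal A,u,\mathfrak O)\right\}\subset \mathrm M_{(d+e)\times(d+e)}(\mathfrak O)$, where $\mathrm{Sym}_d(\mathfrak O)$ is the module of symmetric $d\times d$ matrices. *)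

theory Defs
  imports
    "HOL-Algebra.QuotRing"
    "HOL-Algebra.Ring_Divisibility"
    "HOL-Algebra.Ideal_Product"
    "HOL-Analysis.Abstract_Topology"
    "HOL-Computational_Algebra.Formal_Power_Series"
    "HOL-Library.Disjoint_Sets"
    "Jordan_Normal_Form.Matrix"
begin

definition ideal_power :: "('a, 'b) ring_scheme \<Rightarrow> 'a set \<Rightarrow> nat \<Rightarrow> 'a set" where
  "ideal_power R P n = P [^]\<^bsub>ideals_set R\<^esub> n"

text \<open>
  Two cosets of powers of \<open>P\<close> are disjoint or nested, so these sets form a basis of the topology
  they generate.
\<close>

definition adic_topology :: "('a, 'b) ring_scheme \<Rightarrow> 'a set \<Rightarrow> 'a topology" where
  "adic_topology R P =
     topology_generated_by {ideal_power R P n +>\<^bsub>R\<^esub> a | n a. a \<in> carrier R}"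

locale discrete_valuation_ring = principal_domain R for R (structure) +
  fixes P
  assumes maximal: "maximalideal P R"
    and unique_maximal: "maximalideal J R \<Longrightarrow> J = P"
    and not_field: "P \<noteq> {\<zero>}"

locale compact_discrete_valuation_ring = discrete_valuation_ring R P
  for R (structure) and P +
  assumes compact: "compact_space (adic_topology R P)"

text \<open>
  Vectors and matrices of the types \<^typ>\<open>'a vec\<close> and \<^typ>\<open>'a mat\<close> are used as containers only;
  the ring operations on entries are those of the given ring record, not type class operations.
  Rows, columns and cells are indexed from 0, so the index set \<open>{1..d}\<close> becomes \<open>{..<d}\<close>.
\<close>

definition mats :: "('a, 'b) ring_scheme \<Rightarrow> nat \<Rightarrow> nat \<Rightarrow> 'a mat set" where
  "mats R d e = {a \<in> carrier_mat d e. elements_mat a \<subseteq> carrier R}"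

definition sym_mats :: "('a, 'b) ring_scheme \<Rightarrow> nat \<Rightarrow> 'a mat set" where
  "sym_mats R d = {a \<in> mats R d d. transpose_mat a = a}"

definition row_mult :: "('a, 'b) ring_scheme \<Rightarrow> 'a vec \<Rightarrow> 'a mat \<Rightarrow> 'a vec" where
  "row_mult S x a =
     vec (dim_col a)
       (\<lambda>j. finsum S (\<lambda>i. vec_index x i \<otimes>\<^bsub>S\<^esub> index_mat a (i, j)) {..<dim_row a})"

definition Ker :: "('a, 'b) ring_scheme \<Rightarrow> 'a mat \<Rightarrow> 'a vec set" where
  "Ker S a = {x \<in> carrier_vec (dim_row a).
     vec_set x \<subseteq> carrier S \<and> row_mult S x a = vec (dim_col a) (\<lambda>_. \<zero>\<^bsub>S\<^esub>)}"

definition ask :: "('a, 'b) ring_scheme \<Rightarrow> 'a mat set \<Rightarrow> rat" where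
  "ask S A = (\<Sum>a\<in>A. of_nat (card (Ker S a))) / of_nat (card A)"

definition reduce_mats :: "('a, 'b) ring_scheme \<Rightarrow> 'a set \<Rightarrow> 'a mat set \<Rightarrow> 'a set mat set" where
  "reduce_mats R I M = map_mat (\<lambda>x. I +>\<^bsub>R\<^esub> x) ` M"

text \<open>
  Since \<open>ideal_power R P 0 = carrier R\<close>, the constant coefficient is taken over the zero ring.
\<close>

definition ask_zeta :: "('a, 'b) ring_scheme \<Rightarrow> 'a set \<Rightarrow> 'a mat set \<Rightarrow> rat fps" where
  "ask_zeta R P M =
     Abs_fps (\<lambda>n. ask (R Quot ideal_power R P n) (reduce_mats R (ideal_power R P n) M))"

definition partial_colouring ::
    "nat \<Rightarrow> nat \<Rightarrow> 'c set \<Rightarrow> ('c \<Rightarrow> (nat \<times> nat) set) \<Rightarrow> bool" where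
  "partial_colouring d e C A \<longleftrightarrow>
     (\<forall>c\<in>C. A c \<subseteq> {..<d} \<times> {..<e}) \<and> disjoint_family_on A C"

definition blank :: "'c set \<Rightarrow> ('c \<Rightarrow> (nat \<times> nat) set) \<Rightarrow> nat \<times> nat \<Rightarrow> bool" where
  "blank C A z \<longleftrightarrow> (\<forall>c\<in>C. z \<notin> A c)"

definition subgrid :: "nat \<Rightarrow> nat \<Rightarrow> (nat \<times> nat) set \<Rightarrow> bool" where
  "subgrid d e G \<longleftrightarrow> (\<exists>I J. I \<subseteq> {..<d} \<and> J \<subseteq> {..<e} \<and> G = I \<times> J)"

definition colour_closed ::
    "'c set \<Rightarrow> ('c \<Rightarrow> (nat \<times> nat) set) \<Rightarrow> (nat \<times> nat) set \<Rightarrow> bool" where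
  "colour_closed C A G \<longleftrightarrow> (\<forall>c\<in>C. A c \<inter> G \<noteq> {} \<longrightarrow> A c \<subseteq> G)"

definition admissible ::
    "nat \<Rightarrow> nat \<Rightarrow> 'c set \<Rightarrow> ('c \<Rightarrow> (nat \<times> nat) set) \<Rightarrow> bool" where
  "admissible d e C A \<longleftrightarrow>
     (\<forall>G. subgrid d e G \<and> G \<noteq> {} \<and> colour_closed C A G \<longrightarrow> (\<exists>z\<in>G. blank C A z))"

definition Rel_mats ::
    "('a, 'b) ring_scheme \<Rightarrow> nat \<Rightarrow> nat \<Rightarrow> 'c set \<Rightarrow> ('c \<Rightarrow> (nat \<times> nat) set) \<Rightarrow> 'a mat \<Rightarrow> 'a mat set"
  where
  "Rel_mats R d e C A u =
     {x \<in> mats R d e.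
        \<forall>c\<in>C. finsum R (\<lambda>z. index_mat u z \<otimes>\<^bsub>R\<^esub> index_mat x z) (A c) = \<zero>\<^bsub>R\<^esub>}"

definition SRel_mats ::
    "('a, 'b) ring_scheme \<Rightarrow> nat \<Rightarrow> nat \<Rightarrow> 'c set \<Rightarrow> ('c \<Rightarrow> (nat \<times> nat) set) \<Rightarrow> 'a mat \<Rightarrow> 'a mat set"
  where
  "SRel_mats R d e C A u =
     {four_block_mat a x (transpose_mat x) b | a x b.
        a \<in> sym_mats R d \<and> b \<in> sym_mats R e \<and> x \<in> Rel_mats R d e C A u}"

end

(*
  Summing over the vectors x of S^m, S = O/P^n, m = d + e, instead of over the matrices turns the
  average kernel size of M_n = SRel mod P^n into the sum of 1 / |x M_n|.  If x = p^k y with y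
  primitive, then x M_n = p^k S^m as soon as y M_n = S^m, so that the sum only depends on the
  number of x of each valuation and equals 1 + n (1 - q^(-m)).

  By Nakayama it remains to see that y SRel = O^m mod P for primitive y.  The symmetric diagonal
  blocks produce every unit vector of a block in which y has a unit entry.  If unit vectors of the
  other block were missing, the unit positions of y in the first block and the missing positions in
  the second would span a non-empty subgrid.  A blank cell in it yields a missing unit vector, and
  so does a pair of cells of the same colour, one inside and one outside the subgrid; by
  admissibility one of the two exists.
*)
theory Submission
  imports Defs
begin

text \<open>Let the unit entry y_i lie in the first block and let e_(d+j) be missing. If (i, j) and
  (i', j') have the same colour, the matrix with u_ij^-1 at (i, j) and -u_i'j'^-1 at (i', j'),
  extended symmetrically, satisfies all relations. Its product with y consists of a unit multiple of
  e_(d+j), of multiples of e_i and e_i', which are available, and of a multiple of y_i' e_(d+j').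
  Only the last term could obstruct, and (i', j') lying outside the subgrid says exactly that it
  does not: y_i' vanishes modulo P, or e_(d+j') is not missing. This dictates both the choice of the
  two index sets and the reduction modulo P, since over O/P^n a nonunit coefficient need not vanish.

  The case n = 0 runs along with the others: O/P^0 is the zero ring, its only element is a unit, and
  every vector over it is primitive. For all n the zero vector counts as p^n times a primitive
  vector, so it needs no exception either.\<close>

lemma card_eq_card_image_times_fibre:
  assumes fin: "finite (f ` G)" and K: "\<And>g. g \<in> G \<Longrightarrow> card {h \<in> G. f h = f g} = K" and "K > 0"
  shows "finite G" and "card G = card (f ` G) * K"
proof -
  have un: "G = (\<Union>v\<in>f ` G. {h \<in> G. f h = v})" by auto
  have card: "card {h \<in> G. f h = v} = K" if "v \<in> f ` G" for v using that K by auto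
  \<comment> \<open>An infinite set has \<open>card\<close> zero, so \<open>K > 0\<close> makes
    every fibre finite. This is the source of the finiteness of \<open>G\<close>.\<close>
  have fib: "finite {h \<in> G. f h = v}" if "v \<in> f ` G" for v
    by (rule card_ge_0_finite) (simp add: card[OF that] \<open>K > 0\<close>)
  have "finite (\<Union>v\<in>f ` G. {h \<in> G. f h = v})" using fin fib by (rule finite_UN_I)
  then show "finite G" unfolding un[symmetric] .
  have "card G = card (\<Union>v\<in>f ` G. {h \<in> G. f h = v})"
    by (rule arg_cong[OF un])
  also have "\<dots> = (\<Sum>v\<in>f ` G. card {h \<in> G. f h = v})"
    by (rule card_UN_disjoint) (use fin fib in auto)
  also have "\<dots> = card (f ` G) * K" using card by simp
  finally show "card G = card (f ` G) * K" .
qed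

lemma card_filter: "finite V \<Longrightarrow> card {x \<in> V. Q x} = (\<Sum>x\<in>V. if Q x then 1 else 0)"
  unfolding card_eq_sum by (rule sum.inter_filter)

section \<open>Vectors and matrices with entries in a given finite set\<close>

definition vecs :: "'a set \<Rightarrow> nat \<Rightarrow> 'a vec set" where
  "vecs B m = {x \<in> carrier_vec m. vec_set x \<subseteq> B}"

lemma vecs_iff: "x \<in> vecs B m \<longleftrightarrow> dim_vec x = m \<and> (\<forall>i<m. x $ i \<in> B)"
  unfolding vecs_def vec_set_def carrier_vec_def image_subset_iff by blast

lemma bij_betw_vec_vecs: "bij_betw (vec m) ({..<m} \<rightarrow>\<^sub>E B) (vecs B m)"
proof (rule bij_betw_byWitness[where f' = "\<lambda>x. restrict (vec_index x) {..<m}"])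
  show "\<forall>f\<in>{..<m} \<rightarrow>\<^sub>E B. restrict (vec_index (vec m f)) {..<m} = f"
  proof
    fix f assume "f \<in> {..<m} \<rightarrow>\<^sub>E B"
    then have "restrict f {..<m} = f" by (rule PiE_restrict)
    moreover have "restrict (vec_index (vec m f)) {..<m} = restrict f {..<m}"
      by (rule restrict_ext) simp
    ultimately show "restrict (vec_index (vec m f)) {..<m} = f" by simp
  qed
  show "\<forall>x\<in>vecs B m. vec m (restrict (vec_index x) {..<m}) = x"
    by (simp add: vecs_iff vec_eq_iff)
  show "vec m ` ({..<m} \<rightarrow>\<^sub>E B) \<subseteq> vecs B m"
    by (intro image_subsetI) (simp add: vecs_iff PiE_iff)
  show "(\<lambda>x. restrict (vec_index x) {..<m}) ` vecs B m \<subseteq> ({..<m} \<rightarrow>\<^sub>E B)"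
    by (intro image_subsetI) (simp add: vecs_iff PiE_iff)
qed

lemma card_vecs: "finite B \<Longrightarrow> card (vecs B m) = card B ^ m"
  using bij_betw_same_card[OF bij_betw_vec_vecs[of m B]] by (simp add: card_PiE)

lemma finite_vecs: "finite B \<Longrightarrow> finite (vecs B m)"
  using bij_betw_finite[OF bij_betw_vec_vecs[of m B]] by (simp add: finite_PiE)

lemma mats_iff:
  "a \<in> mats R d e \<longleftrightarrow> dim_row a = d \<and> dim_col a = e \<and> (\<forall>i<d. \<forall>j<e. a $$ (i, j) \<in> carrier R)"
proof -
  have "elements_mat a = {a $$ (i, j) | i j. i < dim_row a \<and> j < dim_col a}"
    unfolding elements_mat_def by force
  then show ?thesis unfolding mats_def by auto
qed

lemma finite_mats:
  assumes "finite (carrier R)" shows "finite (mats R d e)"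
proof (rule finite_surj)
  show "finite (({..<d} \<times> {..<e}) \<rightarrow>\<^sub>E carrier R)"
    using assms by (intro finite_PiE finite_cartesian_product finite_lessThan)
  show "mats R d e \<subseteq> mat d e ` (({..<d} \<times> {..<e}) \<rightarrow>\<^sub>E carrier R)"
  proof
    fix a assume a: "a \<in> mats R d e"
    show "a \<in> mat d e ` (({..<d} \<times> {..<e}) \<rightarrow>\<^sub>E carrier R)"
    proof (rule image_eqI)
      show "a = mat d e (restrict (($$) a) ({..<d} \<times> {..<e}))"
        using a by (intro eq_matI) (simp_all add: mats_iff)
      show "restrict (($$) a) ({..<d} \<times> {..<e}) \<in> ({..<d} \<times> {..<e}) \<rightarrow>\<^sub>E carrier R"
        using a by (intro restrict_PiE_iff[THEN iffD2] ballI) (clarsimp simp: mats_iff)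
    qed
  qed
qed

section \<open>Counting the pairs (x, a) with x a = 0 in two ways\<close>

definition mat_sum :: "('a, 'b) ring_scheme \<Rightarrow> 'a mat \<Rightarrow> 'a mat \<Rightarrow> 'a mat" where
  "mat_sum R a b = mat (dim_row a) (dim_col a) (\<lambda>z. a $$ z \<oplus>\<^bsub>R\<^esub> b $$ z)"

definition mat_diff :: "('a, 'b) ring_scheme \<Rightarrow> 'a mat \<Rightarrow> 'a mat \<Rightarrow> 'a mat" where
  "mat_diff R a b = mat (dim_row a) (dim_col a) (\<lambda>z. a $$ z \<ominus>\<^bsub>R\<^esub> b $$ z)"

lemma dim_mat_sum [simp]: "dim_row (mat_sum R a b) = dim_row a" "dim_col (mat_sum R a b) = dim_col a"
  by (simp_all add: mat_sum_def)

lemma dim_mat_diff [simp]: "dim_row (mat_diff R a b) = dim_row a" "dim_col (mat_diff R a b) = dim_col a"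
  by (simp_all add: mat_diff_def)

context cring
begin

lemma row_mult_index: "j < dim_col a \<Longrightarrow>
   row_mult R x a $ j = (\<Oplus>i\<in>{..<dim_row a}. x $ i \<otimes> a $$ (i, j))"
  by (simp add: row_mult_def)

lemma dim_row_mult [simp]: "dim_vec (row_mult R x a) = dim_col a"
  by (simp add: row_mult_def)

lemma row_mult_vecs: "x \<in> vecs (carrier R) d \<Longrightarrow> a \<in> mats R d e \<Longrightarrow> row_mult R x a \<in> vecs (carrier R) e"
  unfolding vecs_iff mats_iff by (simp add: row_mult_index Pi_iff)

lemma row_mult_mat_sum:
  assumes "x \<in> vecs (carrier R) d" "a \<in> mats R d e" "b \<in> mats R d e"
  shows "row_mult R x (mat_sum R a b) = vec e (\<lambda>j. row_mult R x a $ j \<oplus> row_mult R x b $ j)"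
proof (rule eq_vecI)
  have dims: "dim_row a = d" "dim_col a = e" "dim_row b = d" "dim_col b = e"
    using assms by (simp_all add: mats_iff)
  have x: "x $ i \<in> carrier R" if "i < d" for i using that assms by (simp add: vecs_iff)
  have a: "a $$ (i, j) \<in> carrier R" "b $$ (i, j) \<in> carrier R" if "i < d" "j < e" for i j
    using that assms by (simp_all add: mats_iff)
  show "dim_vec (row_mult R x (mat_sum R a b)) = dim_vec (vec e (\<lambda>j. row_mult R x a $ j \<oplus> row_mult R x b $ j))"
    by (simp add: dims)
  fix j assume "j < dim_vec (vec e (\<lambda>j. row_mult R x a $ j \<oplus> row_mult R x b $ j))"
  then have j: "j < e" by simp
  have "row_mult R x (mat_sum R a b) $ j = (\<Oplus>i\<in>{..<d}. x $ i \<otimes> mat_sum R a b $$ (i, j))"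
    using j by (simp add: row_mult_index dims)
  also have "\<dots> = (\<Oplus>i\<in>{..<d}. x $ i \<otimes> a $$ (i, j) \<oplus> x $ i \<otimes> b $$ (i, j))"
    using x a j dims by (intro finsum_cong') (auto simp: mat_sum_def r_distr)
  also have "\<dots> = (\<Oplus>i\<in>{..<d}. x $ i \<otimes> a $$ (i, j)) \<oplus> (\<Oplus>i\<in>{..<d}. x $ i \<otimes> b $$ (i, j))"
    using x a j by (intro finsum_addf) auto
  also have "\<dots> = vec e (\<lambda>j. row_mult R x a $ j \<oplus> row_mult R x b $ j) $ j"
    using j by (simp add: row_mult_index dims)
  finally show "row_mult R x (mat_sum R a b) $ j =
       vec e (\<lambda>j. row_mult R x a $ j \<oplus> row_mult R x b $ j) $ j" .
qed

lemma mat_sum_diff: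
  assumes "a \<in> mats R d e" "b \<in> mats R d e"
  shows "mat_sum R (mat_diff R a b) b = a" and "mat_diff R (mat_sum R a b) b = a"
proof -
  have *: "(x \<ominus> y) \<oplus> y = x" "(x \<oplus> y) \<ominus> y = x" if "x \<in> carrier R" "y \<in> carrier R" for x y
    using that by algebra+
  show "mat_sum R (mat_diff R a b) b = a" and "mat_diff R (mat_sum R a b) b = a"
    using assms by (intro eq_matI; simp add: mats_iff mat_diff_def mat_sum_def *)+
qed

text \<open>Closure under sums and differences makes \<open>M\<close> an additive group on which a
  -> x a is additive. Subtracting g therefore maps the fibre through g bijectively onto the
  annihilator of x in \<open>M\<close>, so all fibres have the same size.\<close>

lemma card_row_mult_image:
  assumes M: "M \<subseteq> mats R m m" and fin: "finite M"
    and add: "\<And>a b. a \<in> M \<Longrightarrow> b \<in> M \<Longrightarrow> mat_sum R a b \<in> M"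
    and sub: "\<And>a b. a \<in> M \<Longrightarrow> b \<in> M \<Longrightarrow> mat_diff R a b \<in> M"
    and x: "x \<in> vecs (carrier R) m" and ne: "M \<noteq> {}"
  shows "card M = card (row_mult R x ` M) * card {a \<in> M. row_mult R x a = vec m (\<lambda>_. \<zero>)}"
proof (rule card_eq_card_image_times_fibre(2))
  let ?z = "vec m (\<lambda>_. \<zero>)"
  have dist: "row_mult R x (mat_sum R a b) =
      vec m (\<lambda>j. row_mult R x a $ j \<oplus> row_mult R x b $ j)" if "a \<in> M" "b \<in> M" for a b
    using row_mult_mat_sum[OF x] M that by blast
  have v: "row_mult R x a \<in> vecs (carrier R) m" if "a \<in> M" for a
    using row_mult_vecs[OF x] M that by blast
  have cancel: "row_mult R x (mat_diff R a g) = ?z" if "a \<in> M" "g \<in> M" "row_mult R x a = row_mult R x g" for a g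
  proof (rule eq_vecI)
    have "dim_col (mat_diff R a g) = m" using that M by (auto simp: mat_diff_def mats_iff)
    then show "dim_vec (row_mult R x (mat_diff R a g)) = dim_vec ?z" by simp
    fix j assume "j < dim_vec ?z"
    then have j: "j < m" by simp
    have d: "mat_diff R a g \<in> M" using sub that by blast
    have sum: "row_mult R x a = row_mult R x (mat_sum R (mat_diff R a g) g)"
      using mat_sum_diff(1)[OF subsetD[OF M that(1)] subsetD[OF M that(2)]] by simp
    have "row_mult R x a $ j = row_mult R x (mat_diff R a g) $ j \<oplus> row_mult R x g $ j"
      using j by (subst sum) (simp add: dist[OF d that(2)])
    then have *: "row_mult R x g $ j = row_mult R x (mat_diff R a g) $ j \<oplus> row_mult R x g $ j"
      unfolding that(3) .
    have "row_mult R x g $ j \<in> carrier R" "row_mult R x (mat_diff R a g) $ j \<in> carrier R"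
      using v[OF d] v[OF that(2)] j by (simp_all add: vecs_iff)
    then have "row_mult R x (mat_diff R a g) $ j = \<zero>"
      using * by (metis add.r_cancel_one')
    then show "row_mult R x (mat_diff R a g) $ j = ?z $ j" using j by simp
  qed
  have z: "row_mult R x (mat_sum R a g) = row_mult R x g" if "a \<in> M" "g \<in> M" "row_mult R x a = ?z" for a g
  proof -
    have "row_mult R x (mat_sum R a g) = vec m (\<lambda>j. ?z $ j \<oplus> row_mult R x g $ j)"
      unfolding dist[OF that(1,2)] that(3) ..
    also have "\<dots> = row_mult R x g" using v[OF that(2)] by (auto simp: vecs_iff intro!: eq_vecI)
    finally show ?thesis .
  qed
  show "card {h \<in> M. row_mult R x h = row_mult R x g} = card {a \<in> M. row_mult R x a = ?z}"
    if g: "g \<in> M" for g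
  proof (rule bij_betw_same_card, rule bij_betw_byWitness[where f = "\<lambda>a. mat_diff R a g" and f' = "\<lambda>a. mat_sum R a g"])
    show "\<forall>a\<in>{h \<in> M. row_mult R x h = row_mult R x g}. mat_sum R (mat_diff R a g) g = a"
      and "\<forall>a'\<in>{a \<in> M. row_mult R x a = ?z}. mat_diff R (mat_sum R a' g) g = a'"
      using mat_sum_diff[OF _ subsetD[OF M g]] M by blast+
    show "(\<lambda>a. mat_diff R a g) ` {h \<in> M. row_mult R x h = row_mult R x g} \<subseteq> {a \<in> M. row_mult R x a = ?z}"
      using sub[OF _ g] cancel[OF _ g] by blast
    show "(\<lambda>a. mat_sum R a g) ` {a \<in> M. row_mult R x a = ?z} \<subseteq> {h \<in> M. row_mult R x h = row_mult R x g}"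
      using add[OF _ g] z[OF _ g] by blast
  qed
  \<comment> \<open>The zero matrix, obtained as g - g, lies in the annihilator, which is therefore
    non-empty.\<close>
  obtain g where g: "g \<in> M" using ne by blast
  then have "mat_diff R g g \<in> {a \<in> M. row_mult R x a = ?z}" using cancel[OF g g refl] sub by simp
  moreover have "finite {a \<in> M. row_mult R x a = ?z}" using fin by simp
  ultimately show "card {a \<in> M. row_mult R x a = ?z} > 0"
    by (metis card_gt_0_iff empty_iff)
qed (use fin in simp)

text \<open>After the sum over the pairs (x, a) with x a = 0 is swapped, a fixed x contributes the
  size of its annihilator in \<open>M\<close>, which is |M| / |x M| by
  \<open>card_row_mult_image\<close>.\<close>

lemma ask_eq_sum_inverse_card:
  assumes fin: "finite (carrier R)" and M: "M \<subseteq> mats R m m" and ne: "M \<noteq> {}"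
    and add: "\<And>a b. a \<in> M \<Longrightarrow> b \<in> M \<Longrightarrow> mat_sum R a b \<in> M"
    and sub: "\<And>a b. a \<in> M \<Longrightarrow> b \<in> M \<Longrightarrow> mat_diff R a b \<in> M"
  shows "ask R M = (\<Sum>x\<in>vecs (carrier R) m. 1 / of_nat (card (row_mult R x ` M)))"
proof -
  let ?V = "vecs (carrier R) m" and ?z = "vec m (\<lambda>_. \<zero>)"
  have finM: "finite M" using M finite_mats[OF fin] finite_subset by blast
  have finV: "finite ?V" using fin by (rule finite_vecs)
  have pos: "card M > 0" using finM ne by (simp add: card_gt_0_iff)
  have Ker: "Ker R a = {x \<in> ?V. row_mult R x a = ?z}" if "a \<in> M" for a
  proof -
    have "dim_row a = m" "dim_col a = m" using that M by (auto simp: mats_iff)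
    then show ?thesis by (simp add: Ker_def vecs_def conj_assoc)
  qed
  have "(\<Sum>a\<in>M. card (Ker R a)) = (\<Sum>a\<in>M. \<Sum>x\<in>?V. if row_mult R x a = ?z then 1 else 0)"
    by (intro sum.cong refl) (simp add: Ker card_filter[OF finV])
  also have "\<dots> = (\<Sum>x\<in>?V. \<Sum>a\<in>M. if row_mult R x a = ?z then 1 else 0)" by (rule sum.swap)
  also have "\<dots> = (\<Sum>x\<in>?V. card {a \<in> M. row_mult R x a = ?z})"
    by (intro sum.cong refl) (simp add: card_filter[OF finM])
  finally have eq: "(\<Sum>a\<in>M. card (Ker R a)) = (\<Sum>x\<in>?V. card {a \<in> M. row_mult R x a = ?z})" .
  have "ask R M = of_nat (\<Sum>a\<in>M. card (Ker R a)) / of_nat (card M)"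
    by (simp add: ask_def)
  also have "\<dots> = (\<Sum>x\<in>?V. of_nat (card {a \<in> M. row_mult R x a = ?z}) / of_nat (card M))"
    unfolding eq by (simp add: sum_divide_distrib)
  also have "\<dots> = (\<Sum>x\<in>?V. 1 / of_nat (card (row_mult R x ` M)))"
  proof (intro sum.cong refl)
    fix x assume "x \<in> ?V"
    then have "card M = card (row_mult R x ` M) * card {a \<in> M. row_mult R x a = ?z}" (is "_ = ?I * ?K")
      using card_row_mult_image[OF M finM add sub _ ne] by blast
    then have "(of_nat (card M) :: rat) = of_nat ?I * of_nat ?K" and "?I \<noteq> 0" "?K \<noteq> 0"
      using pos by (metis of_nat_mult, metis mult_0 less_irrefl, metis mult_0_right less_irrefl)
    then show "of_nat ?K / of_nat (card M) = (1 / of_nat ?I :: rat)" by simp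
  qed
  finally show ?thesis .
qed

end


section \<open>Average kernel sizes over finite chain rings\<close>

text \<open>Models O/P^n, with \<open>p\<close> the image of a uniformizer and \<open>q\<close> the
  size of the residue field. In \<open>factor\<close> the exponent n is allowed, so that zero also
  is a power of \<open>p\<close> times a unit. For n = 0 this is the zero ring.\<close>

locale finite_chain_ring = cring R for R (structure) +
  fixes p :: 'a and n q :: nat
  assumes p_closed [simp]: "p \<in> carrier R"
    and finite_carrier: "finite (carrier R)"
    and factor: "a \<in> carrier R \<Longrightarrow> \<exists>k\<le>n. \<exists>u\<in>Units R. a = p [^] k \<otimes> u"
    and card_multiples: "k \<le> n \<Longrightarrow> card ((\<lambda>b. p [^] k \<otimes> b) ` carrier R) = q ^ (n - k)"
    and q_ge_2: "q \<ge> 2"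
begin

definition multiples :: "nat \<Rightarrow> 'a set" where
  "multiples k = (\<lambda>b. p [^] k \<otimes> b) ` carrier R"

lemma multiplesI: "b \<in> carrier R \<Longrightarrow> p [^] k \<otimes> b \<in> multiples k"
  unfolding multiples_def by (rule imageI)

lemma multiplesE:
  assumes "a \<in> multiples k" obtains b where "b \<in> carrier R" "a = p [^] k \<otimes> b"
  using assms unfolding multiples_def by blast

lemma multiples_subset_carrier: "multiples k \<subseteq> carrier R"
  unfolding multiples_def by (rule image_subsetI) simp

lemma finite_multiples: "finite (multiples k)"
  using multiples_subset_carrier finite_carrier by (rule finite_subset)

lemma multiples_antimono: "j \<le> k \<Longrightarrow> multiples k \<subseteq> multiples j"
proof
  fix a assume "j \<le> k" "a \<in> multiples k"
  then obtain b where b: "b \<in> carrier R" "a = p [^] k \<otimes> b" by (rule_tac multiplesE)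
  have "p [^] k = p [^] j \<otimes> p [^] (k - j)" using \<open>j \<le> k\<close> by (simp add: nat_pow_mult)
  then have "a = p [^] j \<otimes> (p [^] (k - j) \<otimes> b)" using b by (simp add: m_assoc)
  then show "a \<in> multiples j" using b multiplesI[of "p [^] (k - j) \<otimes> b" j] by simp
qed

lemma multiples_0: "multiples 0 = carrier R"
  unfolding multiples_def by simp

lemma multiples_n: "multiples n = {\<zero>}"
proof -
  have "\<zero> \<in> multiples n" using multiplesI[of \<zero> n] by simp
  moreover have "card (multiples n) = 1" using card_multiples[of n] by (simp add: multiples_def)
  ultimately show ?thesis by (metis card_1_singletonE singletonD)
qed

text \<open>There are zero divisors in general, so p^k cannot be cancelled; cardinalities replace
  cancellation. If p^k u were a multiple of p^(k+1), the ideals generated by p^k and p^(k+1) would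
  coincide, but their sizes are q^(n-k) and q^(n-k-1).\<close>

lemma unit_multiple_notin:
  assumes "k < n" "u \<in> Units R" shows "p [^] k \<otimes> u \<notin> multiples (Suc k)"
proof
  assume "p [^] k \<otimes> u \<in> multiples (Suc k)"
  then obtain b where b: "b \<in> carrier R" "p [^] k \<otimes> u = p [^] Suc k \<otimes> b" by (rule multiplesE)
  have u: "u \<in> carrier R" "inv u \<in> carrier R" "u \<otimes> inv u = \<one>" using assms(2) by (simp_all add: Units_closed)
  have pk: "p [^] k = p [^] Suc k \<otimes> (b \<otimes> inv u)"
  proof -
    have "p [^] k = (p [^] k \<otimes> u) \<otimes> inv u" using u by (simp add: m_assoc)
    also have "\<dots> = (p [^] Suc k \<otimes> b) \<otimes> inv u" using b(2) by (rule arg_cong)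
    also have "\<dots> = p [^] Suc k \<otimes> (b \<otimes> inv u)" using b(1) u by (intro m_assoc) simp_all
    finally show ?thesis .
  qed
  have "multiples k \<subseteq> multiples (Suc k)"
  proof
    fix a assume "a \<in> multiples k"
    then obtain c where c: "c \<in> carrier R" "a = p [^] k \<otimes> c" by (rule multiplesE)
    have "a = (p [^] Suc k \<otimes> (b \<otimes> inv u)) \<otimes> c" using c(2) pk by (rule back_subst[of "\<lambda>z. a = z \<otimes> c"])
    also have "\<dots> = p [^] Suc k \<otimes> (b \<otimes> inv u \<otimes> c)" using b(1) u c(1) by (intro m_assoc) simp_all
    finally show "a \<in> multiples (Suc k)" using b(1) u c(1) multiplesI[of "b \<otimes> inv u \<otimes> c" "Suc k"] by simp
  qed
  then have "card (multiples k) \<le> card (multiples (Suc k))" by (rule card_mono[OF finite_multiples])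
  then have "q ^ (n - k) \<le> q ^ (n - Suc k)"
    using card_multiples[of k] card_multiples[of "Suc k"] assms(1) by (simp add: multiples_def)
  moreover have "q ^ (n - Suc k) < q ^ (n - k)"
    using q_ge_2 assms(1) by (intro power_strict_increasing) simp_all
  ultimately show False by simp
qed

text \<open>The smallest exponent k among the entries is factored out, and an entry attaining it
  leaves a unit behind. A zero entry is p^n times a unit, so the zero vector is covered with k =
  n.\<close>

lemma content_primitive:
  assumes x: "x \<in> vecs (carrier R) m" and "m > 0"
  obtains k y where "k \<le> n" "y \<in> vecs (carrier R) m" "\<exists>i<m. y $ i \<in> Units R"
    "x = vec m (\<lambda>i. p [^] k \<otimes> y $ i)"
proof -
  have "\<forall>i\<in>{..<m}. \<exists>k u. k \<le> n \<and> u \<in> Units R \<and> x $ i = p [^] k \<otimes> u"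
    using x factor unfolding vecs_iff by blast
  then obtain f g where fg: "\<And>i. i < m \<Longrightarrow> f i \<le> n" "\<And>i. i < m \<Longrightarrow> g i \<in> Units R"
      "\<And>i. i < m \<Longrightarrow> x $ i = p [^] f i \<otimes> g i"
    by (metis lessThan_iff)
  define k where "k = Min (f ` {..<m})"
  define y where "y = vec m (\<lambda>i. p [^] (f i - k) \<otimes> g i)"
  have ne: "f ` {..<m} \<noteq> {}" using \<open>m > 0\<close> by blast
  have "k \<in> f ` {..<m}" unfolding k_def using ne by (intro Min_in) simp_all
  then obtain i0 where i0: "i0 < m" "k = f i0" by blast
  have le: "k \<le> f i" if "i < m" for i
    unfolding k_def using that by (intro Min_le) simp_all
  have g: "g i \<in> carrier R" if "i < m" for i using fg(2)[OF that] by (rule Units_closed)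
  show ?thesis
  proof (rule that)
    show "k \<le> n" using i0 fg(1) by simp
    show "y \<in> vecs (carrier R) m" unfolding vecs_iff y_def using g by simp
    have "y $ i0 = g i0" unfolding y_def using i0 g by simp
    then show "\<exists>i<m. y $ i \<in> Units R" using i0(1) fg(2) by metis
    show "x = vec m (\<lambda>i. p [^] k \<otimes> y $ i)"
    proof (rule eq_vecI)
      show "dim_vec x = dim_vec (vec m (\<lambda>i. p [^] k \<otimes> y $ i))" using x by (simp add: vecs_iff)
      fix i assume "i < dim_vec (vec m (\<lambda>i. p [^] k \<otimes> y $ i))"
      then have i: "i < m" by simp
      have "p [^] k \<otimes> y $ i = p [^] k \<otimes> p [^] (f i - k) \<otimes> g i"
        unfolding y_def using i g by (simp add: m_assoc)
      also have "\<dots> = p [^] f i \<otimes> g i" using le[OF i] by (simp add: nat_pow_mult)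
      finally show "x $ i = vec m (\<lambda>i. p [^] k \<otimes> y $ i) $ i" using i fg(3) by simp
    qed
  qed
qed

lemma row_mult_smult:
  assumes "y \<in> vecs (carrier R) d" "a \<in> mats R d e" "c \<in> carrier R"
  shows "row_mult R (vec d (\<lambda>i. c \<otimes> y $ i)) a = vec e (\<lambda>j. c \<otimes> row_mult R y a $ j)"
proof (rule eq_vecI)
  have dims: "dim_row a = d" "dim_col a = e" using assms(2) unfolding mats_iff by blast+
  have y: "y $ i \<in> carrier R" if "i < d" for i using that assms(1) unfolding vecs_iff by blast
  have a: "a $$ (i, j) \<in> carrier R" if "i < d" "j < e" for i j
    using that assms(2) unfolding mats_iff by blast
  show "dim_vec (row_mult R (vec d (\<lambda>i. c \<otimes> y $ i)) a) = dim_vec (vec e (\<lambda>j. c \<otimes> row_mult R y a $ j))"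
    by (simp add: dims)
  fix j assume "j < dim_vec (vec e (\<lambda>j. c \<otimes> row_mult R y a $ j))"
  then have j: "j < e" by simp
  have "row_mult R (vec d (\<lambda>i. c \<otimes> y $ i)) a $ j = (\<Oplus>i\<in>{..<d}. vec d (\<lambda>i. c \<otimes> y $ i) $ i \<otimes> a $$ (i, j))"
    using j by (simp add: row_mult_index dims)
  also have "\<dots> = (\<Oplus>i\<in>{..<d}. c \<otimes> (y $ i \<otimes> a $$ (i, j)))"
    using y a[OF _ j] assms(3) by (intro finsum_cong') (simp_all add: m_assoc)
  also have "\<dots> = c \<otimes> (\<Oplus>i\<in>{..<d}. y $ i \<otimes> a $$ (i, j))"
    using y a[OF _ j] assms(3) by (intro finsum_rdistr[symmetric]) simp_all
  also have "\<dots> = vec e (\<lambda>j. c \<otimes> row_mult R y a $ j) $ j"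
    using j by (simp add: row_mult_index dims)
  finally show "row_mult R (vec d (\<lambda>i. c \<otimes> y $ i)) a $ j = vec e (\<lambda>j. c \<otimes> row_mult R y a $ j) $ j" .
qed

end

lemma vecs_mono: "A \<subseteq> B \<Longrightarrow> vecs A m \<subseteq> vecs B m"
  unfolding vecs_def by blast

text \<open>Isolates what the average needs to know about the matrices: they form an additive group
  that maps every primitive vector onto the whole module. \<open>M_onto\<close> is all that has to
  be verified for symmetric relation matrices beyond closure.\<close>

locale primitively_surjective = finite_chain_ring R p n q
  for R :: "('a, 'b) ring_scheme" (structure) and p n q +
  fixes m :: nat and M :: "'a mat set"
  assumes m_pos: "m > 0"
    and M_mats: "M \<subseteq> mats R m m" and M_ne: "M \<noteq> {}"
    and M_sum: "\<And>a b. a \<in> M \<Longrightarrow> b \<in> M \<Longrightarrow> mat_sum R a b \<in> M"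
    and M_diff: "\<And>a b. a \<in> M \<Longrightarrow> b \<in> M \<Longrightarrow> mat_diff R a b \<in> M"
    and M_onto: "\<lbrakk>y \<in> vecs (carrier R) m; \<exists>i<m. y $ i \<in> Units R; v \<in> vecs (carrier R) m\<rbrakk>
      \<Longrightarrow> \<exists>a\<in>M. row_mult R y a = v"
begin

lemma row_mult_image:
  assumes y: "y \<in> vecs (carrier R) m" "\<exists>i<m. y $ i \<in> Units R"
  shows "row_mult R (vec m (\<lambda>i. p [^] k \<otimes> y $ i)) ` M = vecs (multiples k) m"
proof (rule Set.set_eqI)
  fix v
  have eq: "row_mult R (vec m (\<lambda>i. p [^] k \<otimes> y $ i)) a = vec m (\<lambda>j. p [^] k \<otimes> row_mult R y a $ j)"
    if "a \<in> M" for a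
    using y(1) that M_mats by (intro row_mult_smult) auto
  have carr: "row_mult R y a \<in> vecs (carrier R) m" if "a \<in> M" for a
    using row_mult_vecs[OF y(1)] that M_mats by blast
  show "v \<in> row_mult R (vec m (\<lambda>i. p [^] k \<otimes> y $ i)) ` M \<longleftrightarrow> v \<in> vecs (multiples k) m"
  proof
    assume "v \<in> row_mult R (vec m (\<lambda>i. p [^] k \<otimes> y $ i)) ` M"
    then obtain a where "a \<in> M" "v = vec m (\<lambda>j. p [^] k \<otimes> row_mult R y a $ j)" using eq by blast
    then show "v \<in> vecs (multiples k) m"
      using carr[of a] unfolding vecs_iff by (simp add: multiplesI)
  next
    assume v: "v \<in> vecs (multiples k) m"
    then have "\<forall>j\<in>{..<m}. \<exists>b. b \<in> carrier R \<and> v $ j = p [^] k \<otimes> b"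
      unfolding vecs_iff by (blast elim: multiplesE)
    then obtain w where w: "\<And>j. j < m \<Longrightarrow> w j \<in> carrier R" "\<And>j. j < m \<Longrightarrow> v $ j = p [^] k \<otimes> w j"
      by (metis lessThan_iff)
    have "vec m w \<in> vecs (carrier R) m" unfolding vecs_iff using w(1) by simp
    then obtain a where a: "a \<in> M" "row_mult R y a = vec m w" using M_onto[OF y] by blast
    have "v = vec m (\<lambda>j. p [^] k \<otimes> row_mult R y a $ j)"
      unfolding a(2) using v w(2) by (intro eq_vecI) (simp_all add: vecs_iff)
    then have "v = row_mult R (vec m (\<lambda>i. p [^] k \<otimes> y $ i)) a" using eq[OF a(1)] by simp
    then show "v \<in> row_mult R (vec m (\<lambda>i. p [^] k \<otimes> y $ i)) ` M" using a(1) by (rule image_eqI)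
  qed
qed

text \<open>The exponent j found by \<open>content_primitive\<close> must be k: membership at level
  k excludes j < k by \<open>unit_multiple_notin\<close> at a unit entry of y, and failure at level
  \<open>Suc k\<close> excludes j > k. At k = n only the zero vector is left and the chain of ideals
  no longer shrinks, hence the guard \<open>k < n\<close>.\<close>

lemma card_row_mult_image_level:
  assumes k: "k \<le> n" and x: "x \<in> vecs (multiples k) m" and max: "k < n \<Longrightarrow> x \<notin> vecs (multiples (Suc k)) m"
  shows "card (row_mult R x ` M) = q ^ ((n - k) * m)"
proof -
  have "x \<in> vecs (carrier R) m" using x vecs_mono[OF multiples_subset_carrier] by blast
  then obtain j y where jy: "j \<le> n" "y \<in> vecs (carrier R) m" "\<exists>i<m. y $ i \<in> Units R"
      "x = vec m (\<lambda>i. p [^] j \<otimes> y $ i)"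
    using m_pos by (rule content_primitive)
  have xj: "x \<in> vecs (multiples j) m"
    unfolding jy(4) using jy(2) unfolding vecs_iff by (simp add: multiplesI)
  have "j \<le> k"
  proof (rule ccontr)
    assume "\<not> j \<le> k"
    then have "x \<in> vecs (multiples (Suc k)) m" "k < n"
      using xj vecs_mono[OF multiples_antimono[of "Suc k" j]] jy(1) by auto
    then show False using max by blast
  qed
  moreover have "\<not> j < k"
  proof
    assume "j < k"
    obtain i where i: "i < m" "y $ i \<in> Units R" using jy(3) by blast
    have "x $ i \<in> multiples k" using x i(1) unfolding vecs_iff by blast
    then have "p [^] j \<otimes> y $ i \<in> multiples (Suc j)"
      using jy(4) i(1) multiples_antimono[of "Suc j" k] \<open>j < k\<close> by auto
    then show False using unit_multiple_notin[of j "y $ i"] i(2) \<open>j < k\<close> k by simp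
  qed
  ultimately have "j = k" by simp
  then have "row_mult R x ` M = vecs (multiples k) m"
    using row_mult_image[OF jy(2,3)] jy(4) by simp
  then show ?thesis
    using card_multiples[OF k] by (simp add: card_vecs finite_multiples power_mult flip: multiples_def)
qed

text \<open>The induction moves from the zero vector outwards through the submodules p^(n-k) R^m.
  The new layer of step k + 1 has q^((k+1)m) - q^(km) vectors, each of weight q^(-(k+1)m). Its
  contribution 1 - q^(-m) does not depend on k, and the zero vector contributes the initial
  1.\<close>

lemma sum_inverse_card_row_mult_image:
  "k \<le> n \<Longrightarrow> (\<Sum>x\<in>vecs (multiples (n - k)) m. 1 / of_nat (card (row_mult R x ` M)))
     = (1 + of_nat k * (1 - 1 / of_nat q ^ m) :: rat)"
proof (induction k)
  case 0
  have "vec m (\<lambda>_. \<zero>) \<in> vecs (multiples n) m" by (simp add: vecs_iff multiples_n)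
  moreover have "card (vecs (multiples n) m) = 1" by (simp add: card_vecs multiples_n)
  ultimately have "vecs (multiples n) m = {vec m (\<lambda>_. \<zero>)}" by (metis card_1_singletonE singletonD)
  moreover have "card (row_mult R (vec m (\<lambda>_. \<zero>)) ` M) = 1"
    using card_row_mult_image_level[of n "vec m (\<lambda>_. \<zero>)"] by (simp add: vecs_iff multiples_n)
  ultimately show ?case by simp
next
  case (Suc k)
  define l where "l = n - Suc k"
  have l: "l < n" "Suc l = n - k" "n - l = Suc k" using Suc.prems by (simp_all add: l_def)
  let ?A = "vecs (multiples l) m" and ?B = "vecs (multiples (Suc l)) m"
  let ?f = "\<lambda>x. 1 / of_nat (card (row_mult R x ` M)) :: rat"
  have fin: "finite ?A" by (intro finite_vecs finite_multiples)
  have sub: "?B \<subseteq> ?A" by (intro vecs_mono multiples_antimono) simp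
  have cA: "card ?A = q ^ (Suc k * m)" and cB: "card ?B = q ^ (k * m)"
    using card_multiples[of l] card_multiples[of "Suc l"] l Suc.prems
    unfolding card_vecs[OF finite_multiples] power_mult by (simp_all add: multiples_def)
  have q: "(of_nat q :: rat) \<noteq> 0" using q_ge_2 by simp
  have "(\<Sum>x\<in>?A - ?B. ?f x) = (\<Sum>x\<in>?A - ?B. 1 / of_nat q ^ (Suc k * m))"
  proof (intro sum.cong refl)
    fix x assume "x \<in> ?A - ?B"
    then have "card (row_mult R x ` M) = q ^ ((n - l) * m)"
      using l(1) by (intro card_row_mult_image_level) auto
    then show "?f x = 1 / of_nat q ^ (Suc k * m)" unfolding l(3) by simp
  qed
  also have "\<dots> = of_nat (card (?A - ?B)) / of_nat q ^ (Suc k * m)" by simp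
  also have "of_nat (card (?A - ?B)) = (of_nat q ^ (Suc k * m) - of_nat q ^ (k * m) :: rat)"
  proof -
    have "card (?A - ?B) = card ?A - card ?B" by (rule card_Diff_subset[OF finite_subset[OF sub fin] sub])
    moreover have "card ?B \<le> card ?A" by (rule card_mono[OF fin sub])
    ultimately show ?thesis unfolding cA cB by (simp add: of_nat_diff)
  qed
  also have "(of_nat q ^ (Suc k * m) - of_nat q ^ (k * m)) / of_nat q ^ (Suc k * m) = (1 - 1 / of_nat q ^ m :: rat)"
    using q by (simp add: power_add field_simps)
  finally have diff: "(\<Sum>x\<in>?A - ?B. ?f x) = 1 - 1 / of_nat q ^ m" .
  have "(\<Sum>x\<in>?A. ?f x) = (\<Sum>x\<in>?A - ?B. ?f x) + (\<Sum>x\<in>?B. ?f x)"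
    by (rule sum.subset_diff[OF sub fin])
  also have "\<dots> = (1 - 1 / of_nat q ^ m) + (1 + of_nat k * (1 - 1 / of_nat q ^ m))"
    using diff Suc.IH Suc.prems l(2) by simp
  also have "\<dots> = 1 + of_nat (Suc k) * (1 - 1 / of_nat q ^ m)"
    by (simp add: algebra_simps add_divide_distrib)
  finally show ?case unfolding l_def .
qed

theorem ask_eq: "ask R M = 1 + of_nat n * (1 - 1 / of_nat q ^ m)"
proof -
  have "ask R M = (\<Sum>x\<in>vecs (multiples (n - n)) m. 1 / of_nat (card (row_mult R x ` M)))"
    using ask_eq_sum_inverse_card[OF finite_carrier M_mats M_ne M_sum M_diff] multiples_0 by simp
  then show ?thesis using sum_inverse_card_row_mult_image[of n] by simp
qed

end


section \<open>Quotients of a discrete valuation ring\<close>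

text \<open>Both images are in bijection with the classes of the same equivalence relation on
  \<open>A\<close>. This compares quotients by different ideals through maps defined on the ring
  itself, where no choice of representatives arises.\<close>

lemma
  assumes "\<And>a b. a \<in> A \<Longrightarrow> b \<in> A \<Longrightarrow> f a = f b \<longleftrightarrow> g a = g b"
  shows card_image_eq_of_same_fibres: "card (f ` A) = card (g ` A)"
    and finite_image_iff_of_same_fibres: "finite (f ` A) \<longleftrightarrow> finite (g ` A)"
proof -
  let ?h = "\<lambda>y. g (inv_into A f y)"
  have h: "?h (f a) = g a" if "a \<in> A" for a
    using assms[OF inv_into_into[OF imageI[OF that]] that] f_inv_into_f[OF imageI[OF that]] by metis
  have "bij_betw ?h (f ` A) (g ` A)"
  proof (rule bij_betw_imageI)
    show "inj_on ?h (f ` A)"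
    proof (rule inj_onI)
      fix y z assume "y \<in> f ` A" "z \<in> f ` A" "?h y = ?h z"
      then obtain a b where "a \<in> A" "b \<in> A" "y = f a" "z = f b" "g a = g b" using h by (metis imageE)
      then show "y = z" using assms by blast
    qed
    show "?h ` (f ` A) = g ` A" using h by (simp add: image_image cong: image_cong)
  qed
  then show "card (f ` A) = card (g ` A)" "finite (f ` A) \<longleftrightarrow> finite (g ` A)"
    by (rule bij_betw_same_card, rule bij_betw_finite)
qed

lemma (in cring) ideal_prod_cgenideal:
  assumes "a \<in> carrier R" "b \<in> carrier R"
  shows "ideal_prod R (PIdl a) (PIdl b) = PIdl (a \<otimes> b)"
proof -
  have "ideal_prod R (PIdl a) (PIdl b) = Idl (PIdl (a \<otimes> b))"
    using ideal_prod_eq_genideal[OF cgenideal_ideal cgenideal_ideal] assms cgenideal_prod by simp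
  also have "\<dots> = PIdl (a \<otimes> b)"
    using cgenideal_ideal[of "a \<otimes> b"] assms
    by (intro subset_antisym genideal_minimal genideal_self) (simp_all add: ideal.Icarr subsetI)
  finally show ?thesis .
qed

lemma (in cring) cgenideal_iff:
  "a \<in> carrier R \<Longrightarrow> x \<in> PIdl a \<longleftrightarrow> (\<exists>b\<in>carrier R. x = a \<otimes> b)"
  unfolding cgenideal_def by (auto simp: m_comm)

lemma (in cring) add_minus_cancel_left:
  assumes "c \<in> carrier R" "x \<in> carrier R" "y \<in> carrier R"
  shows "c \<oplus> x \<ominus> c = x" and "(c \<oplus> x) \<ominus> (c \<oplus> y) = x \<ominus> y"
  using assms by algebra+

lemma (in ring_hom_cring) hom_Units:
  assumes "u \<in> Units R" shows "h u \<in> Units S"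
proof -
  have u: "u \<in> carrier R" "inv u \<in> carrier R" "u \<otimes> inv u = \<one>"
    using assms by (simp_all add: R.Units_closed)
  then have "h u \<otimes>\<^bsub>S\<^esub> h (inv u) = \<one>\<^bsub>S\<^esub>" by (metis hom_mult hom_one)
  moreover have "h (inv u) \<otimes>\<^bsub>S\<^esub> h u = h u \<otimes>\<^bsub>S\<^esub> h (inv u)" using u by (intro S.m_comm) simp_all
  moreover have "h u \<in> carrier S" "h (inv u) \<in> carrier S" using u by simp_all
  ultimately show ?thesis unfolding Units_def by auto
qed

section \<open>Powers of the maximal ideal and factorization by a uniformizer\<close>

locale uniformized_dvr = discrete_valuation_ring R P for R (structure) and P +
  fixes p
  assumes p_closed [simp]: "p \<in> carrier R" and P_eq: "P = PIdl p"

context discrete_valuation_ring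
begin

lemma uniformizer_exists: "\<exists>p. uniformized_dvr R P p"
proof -
  have "ideal P R" using maximal by (rule maximalideal.axioms)
  then obtain p where "p \<in> carrier R" "P = PIdl p" using exists_gen by blast
  then have "uniformized_dvr R P p" by unfold_locales
  then show ?thesis ..
qed

text \<open>In a principal ideal domain a nonzero nonunit has an irreducible divisor, and the ideal
  generated by that divisor is maximal, hence equal to \<open>P\<close>.\<close>

lemma nonunit_in_maximal_ideal:
  assumes "a \<in> carrier R" "a \<notin> Units R" shows "a \<in> P"
proof (cases "a = \<zero>")
  case True
  have "ideal P R" using maximal by (rule maximalideal.axioms)
  then show ?thesis using True by (simp add: additive_subgroup.zero_closed ideal.axioms(1))
next
  case False
  then obtain b where b: "b \<in> carrier R" "ring_irreducible b" "b divides a"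
    using exists_irreducible_divisor[of a] assms by blast
  have "PIdl b = P" using irreducible_imp_maximalideal[OF b(1,2)] by (rule unique_maximal)
  then show ?thesis using b(1,3) unfolding factor_def by (metis cgenideal_iff)
qed

lemma unit_notin_maximal_ideal:
  assumes "a \<in> Units R" shows "a \<notin> P"
proof
  assume "a \<in> P"
  have P: "ideal P R" using maximal by (rule maximalideal.axioms)
  have "a \<otimes> inv a \<in> P" using assms \<open>a \<in> P\<close> by (intro ideal.I_r_closed[OF P]) simp_all
  then have "\<one> \<in> P" using assms by simp
  then have "P = carrier R" by (rule ideal.one_imp_carrier[OF P])
  then show False using maximalideal.I_notcarr[OF maximal] by simp
qed

end

context uniformized_dvr
begin

lemma p_nonzero: "p \<noteq> \<zero>"
proof
  assume "p = \<zero>"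
  have "P = {\<zero>}" unfolding P_eq \<open>p = \<zero>\<close> cgenideal_eq_genideal[OF zero_closed] by (rule genideal_zero)
  then show False using not_field by simp
qed

lemma p_pow_nonzero: "p [^] (k::nat) \<noteq> \<zero>"
  by (induction k) (simp_all add: p_nonzero integral_iff)

lemma ideal_power_eq: "ideal_power R P n = PIdl (p [^] n)"
proof (induction n)
  case 0
  have "PIdl \<one> = carrier R" unfolding cgenideal_eq_genideal[OF one_closed] by (rule genideal_one)
  then show ?case by (simp add: ideal_power_def nat_pow_def ideals_set_def)
next
  case (Suc n)
  have "ideal_power R P (Suc n) = ideal_prod R (ideal_power R P n) P"
    by (simp add: ideal_power_def nat_pow_def ideals_set_def)
  also have "\<dots> = PIdl (p [^] Suc n)" unfolding Suc.IH unfolding P_eq by (simp add: ideal_prod_cgenideal)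
  finally show ?case .
qed

lemma ideal_power_iff: "x \<in> ideal_power R P n \<longleftrightarrow> (\<exists>b\<in>carrier R. x = p [^] n \<otimes> b)"
  unfolding ideal_power_eq by (simp add: cgenideal_iff)

lemma ideal_ideal_power: "ideal (ideal_power R P n) R"
  unfolding ideal_power_eq by (simp add: cgenideal_ideal)

lemma ideal_power_1: "ideal_power R P 1 = P"
  unfolding ideal_power_eq by (simp add: P_eq)

lemma ideal_power_0: "ideal_power R P 0 = carrier R"
  using ideal_power_iff[of _ 0] by auto

text \<open>Truncation at n avoids having to show that the powers of \<open>P\<close> intersect in
  zero: each step takes out one more factor \<open>p\<close>, or stops at a unit.\<close>

lemma valuation_cases:
  assumes "a \<in> carrier R"
  shows "a \<in> ideal_power R P n \<or> (\<exists>k<n. \<exists>u\<in>Units R. a = p [^] k \<otimes> u)"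
proof (induction n)
  case 0
  then show ?case using assms by (simp add: ideal_power_0)
next
  case (Suc n)
  show ?case
  proof (cases "a \<in> ideal_power R P n")
    case True
    then obtain b where b: "b \<in> carrier R" "a = p [^] n \<otimes> b" unfolding ideal_power_iff by blast
    show ?thesis
    proof (cases "b \<in> Units R")
      case True
      then show ?thesis using b(2) by blast
    next
      case False
      then have "b \<in> P" using b(1) nonunit_in_maximal_ideal by blast
      then obtain c where c: "c \<in> carrier R" "b = p \<otimes> c" unfolding P_eq by (auto simp: cgenideal_iff)
      then have "a = p [^] Suc n \<otimes> c" using b(2) by (simp add: m_assoc)
      then show ?thesis using c(1) unfolding ideal_power_iff by blast
    qed
  next
    case False
    then show ?thesis using Suc.IH less_SucI by blast
  qed
qed

lemma p_pow_mult_in_ideal_power_iff: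
  assumes "k \<le> n" "a \<in> carrier R"
  shows "p [^] k \<otimes> a \<in> ideal_power R P n \<longleftrightarrow> a \<in> ideal_power R P (n - k)"
proof -
  have pn: "p [^] n = p [^] k \<otimes> p [^] (n - k)" using assms(1) by (simp add: nat_pow_mult)
  have "p [^] k \<otimes> a = p [^] n \<otimes> b \<longleftrightarrow> a = p [^] (n - k) \<otimes> b" if "b \<in> carrier R" for b
  proof -
    have "p [^] n \<otimes> b = p [^] k \<otimes> (p [^] (n - k) \<otimes> b)"
      unfolding pn using that by (intro m_assoc) simp_all
    then show ?thesis using that assms(2) m_lcancel[OF p_pow_nonzero, of k] by simp
  qed
  then show ?thesis unfolding ideal_power_iff by blast
qed

section \<open>The residue rings O/P^n as finite chain rings\<close>

abbreviation quot :: "nat \<Rightarrow> 'a set ring" where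
  "quot n \<equiv> R Quot ideal_power R P n"

abbreviation proj :: "nat \<Rightarrow> 'a \<Rightarrow> 'a set" where
  "proj n \<equiv> (+>) (ideal_power R P n)"

lemma proj_hom: "ring_hom_cring R (quot n) (proj n)"
  using ideal.rcos_ring_hom_cring[OF ideal_ideal_power is_cring] .

lemma carrier_quot: "carrier (quot n) = proj n ` carrier R"
  unfolding FactRing_def A_RCOSETS_def' by auto

lemma proj_eq_iff:
  "a \<in> carrier R \<Longrightarrow> b \<in> carrier R \<Longrightarrow> proj n a = proj n b \<longleftrightarrow> a \<ominus> b \<in> ideal_power R P n"
  using quotient_eq_iff_same_a_r_cos[OF ideal_ideal_power] by simp

lemma proj_p_pow_mult_eq_iff:
  assumes "k \<le> n" "a \<in> carrier R" "b \<in> carrier R"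
  shows "proj n (p [^] k \<otimes> a) = proj n (p [^] k \<otimes> b) \<longleftrightarrow> proj (n - k) a = proj (n - k) b"
proof -
  have "p [^] k \<otimes> a \<ominus> p [^] k \<otimes> b = p [^] k \<otimes> (a \<ominus> b)"
    using assms by (simp add: a_minus_def r_distr r_minus)
  then show ?thesis using assms p_pow_mult_in_ideal_power_iff[of k n "a \<ominus> b"] by (simp add: proj_eq_iff)
qed

lemma multiples_quot:
  fixes k :: nat shows
  "(\<lambda>b. proj n p [^]\<^bsub>quot n\<^esub> k \<otimes>\<^bsub>quot n\<^esub> b) ` carrier (quot n) = (\<lambda>b. proj n (p [^] k \<otimes> b)) ` carrier R"
proof -
  interpret h: ring_hom_cring R "quot n" "proj n" by (rule proj_hom)
  show ?thesis unfolding carrier_quot image_image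
    by (intro image_cong refl) simp
qed

text \<open>Multiplication by p^k identifies R/P^(n-k) with the multiples of p^k in R/P^n: as maps
  on \<open>R\<close>, b -> p^k b modulo P^n and b -> b modulo P^(n-k) have the same fibres.\<close>

lemma
  assumes "k \<le> n"
  shows card_multiples_quot: "card ((\<lambda>b. proj n p [^]\<^bsub>quot n\<^esub> k \<otimes>\<^bsub>quot n\<^esub> b) ` carrier (quot n))
      = card (carrier (quot (n - k)))"
    and finite_multiples_quot: "finite ((\<lambda>b. proj n p [^]\<^bsub>quot n\<^esub> k \<otimes>\<^bsub>quot n\<^esub> b) ` carrier (quot n))
      \<longleftrightarrow> finite (carrier (quot (n - k)))"
  unfolding multiples_quot unfolding carrier_quot
  by (rule card_image_eq_of_same_fibres finite_image_iff_of_same_fibres,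
      simp add: proj_p_pow_mult_eq_iff[OF assms])+

text \<open>The fibre is a coset of P^n/P^(n+1), and t -> p^n t identifies the residue ring with
  that group. The shift by a representative c of g turns the group into the coset.\<close>

lemma card_fibre_mult_p:
  assumes "g \<in> carrier (quot (Suc n))"
  shows "card {h \<in> carrier (quot (Suc n)). proj (Suc n) p \<otimes>\<^bsub>quot (Suc n)\<^esub> h = proj (Suc n) p \<otimes>\<^bsub>quot (Suc n)\<^esub> g}
    = card (carrier (R Quot P))"
proof -
  let ?n = "Suc n"
  interpret h: ring_hom_cring R "quot ?n" "proj ?n" by (rule proj_hom)
  obtain c where c: "c \<in> carrier R" "g = proj ?n c" using assms unfolding carrier_quot by blast
  have iff: "proj ?n p \<otimes>\<^bsub>quot ?n\<^esub> proj ?n d = proj ?n p \<otimes>\<^bsub>quot ?n\<^esub> g \<longleftrightarrow> d \<ominus> c \<in> ideal_power R P n"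
    if "d \<in> carrier R" for d
  proof -
    have "proj ?n p \<otimes>\<^bsub>quot ?n\<^esub> proj ?n d = proj ?n p \<otimes>\<^bsub>quot ?n\<^esub> g \<longleftrightarrow> proj ?n (p [^] (1::nat) \<otimes> d) = proj ?n (p [^] (1::nat) \<otimes> c)"
      using that c by simp
    also have "\<dots> \<longleftrightarrow> proj n d = proj n c"
      using that c proj_p_pow_mult_eq_iff[of 1 ?n d c] by simp
    finally show ?thesis using that c by (simp add: proj_eq_iff)
  qed
  have "{h \<in> carrier (quot ?n). proj ?n p \<otimes>\<^bsub>quot ?n\<^esub> h = proj ?n p \<otimes>\<^bsub>quot ?n\<^esub> g}
      = (\<lambda>t. proj ?n (c \<oplus> p [^] n \<otimes> t)) ` carrier R" (is "?L = ?f ` _")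
  proof (intro equalityI subsetI)
    fix h assume h: "h \<in> ?L"
    then obtain d where d: "d \<in> carrier R" "h = proj ?n d" unfolding carrier_quot by blast
    then have "d \<ominus> c \<in> ideal_power R P n" using h iff by blast
    then obtain t where t: "t \<in> carrier R" "d \<ominus> c = p [^] n \<otimes> t" unfolding ideal_power_iff by blast
    have "d = c \<oplus> (d \<ominus> c)" using c d by algebra
    then have "h = ?f t" unfolding t(2) d(2) by simp
    then show "h \<in> ?f ` carrier R" using t(1) by (rule image_eqI)
  next
    fix h assume "h \<in> ?f ` carrier R"
    then obtain t where t: "t \<in> carrier R" "h = ?f t" by blast
    have "(c \<oplus> p [^] n \<otimes> t) \<ominus> c = p [^] n \<otimes> t" using c t by (intro add_minus_cancel_left) simp_all
    then have "(c \<oplus> p [^] n \<otimes> t) \<ominus> c \<in> ideal_power R P n" unfolding ideal_power_iff using t(1) by blast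
    moreover have "c \<oplus> p [^] n \<otimes> t \<in> carrier R" using c t by simp
    ultimately show "h \<in> ?L" unfolding t(2) carrier_quot using iff by blast
  qed
  moreover have "card (?f ` carrier R) = card (carrier (quot 1))"
    unfolding carrier_quot
  proof (rule card_image_eq_of_same_fibres)
    fix s t assume st: "s \<in> carrier R" "t \<in> carrier R"
    have "(c \<oplus> p [^] n \<otimes> s) \<ominus> (c \<oplus> p [^] n \<otimes> t) = p [^] n \<otimes> s \<ominus> p [^] n \<otimes> t"
      using c st by (intro add_minus_cancel_left) simp_all
    moreover have "c \<oplus> p [^] n \<otimes> s \<in> carrier R" "c \<oplus> p [^] n \<otimes> t \<in> carrier R"
        "p [^] n \<otimes> s \<in> carrier R" "p [^] n \<otimes> t \<in> carrier R"
      using c st by simp_all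
    ultimately have "?f s = ?f t \<longleftrightarrow> proj ?n (p [^] n \<otimes> s) = proj ?n (p [^] n \<otimes> t)"
      by (simp only: proj_eq_iff)
    also have "\<dots> \<longleftrightarrow> proj (?n - n) s = proj (?n - n) t" using st by (intro proj_p_pow_mult_eq_iff) simp_all
    finally show "?f s = ?f t \<longleftrightarrow> proj 1 s = proj 1 t" by simp
  qed
  ultimately show ?thesis unfolding ideal_power_1 by simp
qed

context
  assumes finite_residue: "finite (carrier (R Quot P))"
begin

lemma card_residue_ge_2: "card (carrier (R Quot P)) \<ge> 2"
proof -
  interpret I: ideal P R using maximal by (rule maximalideal.axioms)
  have "P +> \<zero> \<noteq> P +> \<one>"
  proof
    assume "P +> \<zero> = P +> \<one>"
    then have "\<one> \<ominus> \<zero> \<in> P" using quotient_eq_iff_same_a_r_cos[OF I.is_ideal, of \<one> \<zero>] by simp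
    then have "\<one> \<in> P" by (simp add: a_minus_def)
    then show False using unit_notin_maximal_ideal[OF Units_one_closed] by blast
  qed
  then have "card {P +> \<zero>, P +> \<one>} = 2" by simp
  moreover have "{P +> \<zero>, P +> \<one>} \<subseteq> carrier (R Quot P)"
    unfolding FactRing_def A_RCOSETS_def' by auto
  ultimately show ?thesis using card_mono[OF finite_residue] by metis
qed

text \<open>Multiplication by \<open>p\<close> on R/P^(n+1) has an image of the size of R/P^n and
  fibres of the size of the residue ring. Finiteness is carried through the same induction.\<close>

lemma card_quot: "finite (carrier (quot n)) \<and> card (carrier (quot n)) = card (carrier (R Quot P)) ^ n"
proof (induction n)
  case 0
  have "proj 0 a = proj 0 \<zero>" if "a \<in> carrier R" for a
    using that by (simp add: proj_eq_iff) (simp add: ideal_power_0)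
  then have "carrier (quot 0) = (\<lambda>_. proj 0 \<zero>) ` carrier R" unfolding carrier_quot by (rule image_cong[OF refl])
  also have "\<dots> = {proj 0 \<zero>}" by (rule image_constant[OF zero_closed])
  finally have "carrier (quot 0) = {proj 0 \<zero>}" .
  then show ?case by simp
next
  case (Suc n)
  let ?f = "\<lambda>b. proj (Suc n) p \<otimes>\<^bsub>quot (Suc n)\<^esub> b"
  interpret h: ring_hom_cring R "quot (Suc n)" "proj (Suc n)" by (rule proj_hom)
  have "proj (Suc n) p [^]\<^bsub>quot (Suc n)\<^esub> (1::nat) = proj (Suc n) p" by simp
  then have im: "finite (?f ` carrier (quot (Suc n)))" "card (?f ` carrier (quot (Suc n))) = card (carrier (quot n))"
    using finite_multiples_quot[of 1 "Suc n"] card_multiples_quot[of 1 "Suc n"] Suc.IH by simp_all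
  have pos: "card (carrier (R Quot P)) > 0" using card_residue_ge_2 by simp
  show ?case
    using card_eq_card_image_times_fibre[OF im(1) card_fibre_mult_p pos] im(2) Suc.IH by simp
qed

lemma finite_chain_ring_quot:
  "finite_chain_ring (quot n) (proj n p) n (card (carrier (R Quot P)))"
proof -
  interpret h: ring_hom_cring R "quot n" "proj n" by (rule proj_hom)
  show ?thesis
  proof unfold_locales
    show "proj n p \<in> carrier (quot n)" by simp
    show "finite (carrier (quot n))" using card_quot by simp
    show "card (carrier (R Quot P)) \<ge> 2" by (rule card_residue_ge_2)
    show "card ((\<lambda>b. proj n p [^]\<^bsub>quot n\<^esub> k \<otimes>\<^bsub>quot n\<^esub> b) ` carrier (quot n))
        = card (carrier (R Quot P)) ^ (n - k)" if "k \<le> n" for k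
      using card_multiples_quot[OF that] card_quot by simp
    fix x assume "x \<in> carrier (quot n)"
    then obtain a where a: "a \<in> carrier R" "x = proj n a" unfolding carrier_quot by blast
    have "\<exists>k\<le>n. \<exists>u\<in>Units R. x = proj n (p [^] k \<otimes> u)"
      using valuation_cases[OF a(1), of n]
    proof
      assume "a \<in> ideal_power R P n"
      then obtain b where b: "b \<in> carrier R" "a = p [^] n \<otimes> b" unfolding ideal_power_iff by blast
      \<comment> \<open>Both sides are zero in the quotient, so the unit may be chosen to be
        one.\<close>
      have "proj n (p [^] n \<otimes> b) = proj n (p [^] n \<otimes> \<one>)"
        using b(1) proj_p_pow_mult_eq_iff[of n n b \<one>] proj_eq_iff[of b \<one> 0] by (simp add: ideal_power_0)
      then show ?thesis using a(2) b(2) Units_one_closed by blast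
    next
      assume "\<exists>k<n. \<exists>u\<in>Units R. a = p [^] k \<otimes> u"
      then show ?thesis using a(2) less_imp_le by blast
    qed
    then obtain k u where ku: "k \<le> n" "u \<in> Units R" "x = proj n (p [^] k \<otimes> u)" by blast
    have "proj n u \<in> Units (quot n)" using ku(2) by (rule h.hom_Units)
    moreover have "x = proj n p [^]\<^bsub>quot n\<^esub> k \<otimes>\<^bsub>quot n\<^esub> proj n u"
      using ku by (simp add: Units_closed)
    ultimately show "\<exists>k\<le>n. \<exists>u\<in>Units (quot n). x = proj n p [^]\<^bsub>quot n\<^esub> k \<otimes>\<^bsub>quot n\<^esub> u"
      using ku(1) by blast
  qed
qed

end

end

text \<open>Compactness enters the proof here. The cosets of \<open>P\<close> form an open cover,
  and a finite subcover must contain every coset: the member that contains a is a coset meeting P +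
  a, hence equal to it.\<close>

lemma (in compact_discrete_valuation_ring) finite_residue: "finite (carrier (R Quot P))"
proof -
  obtain p where "uniformized_dvr R P p" using uniformizer_exists by blast
  then interpret uniformized_dvr R P p .
  let ?X = "adic_topology R P"
  have C: "carrier (R Quot P) = (+>) P ` carrier R"
    using carrier_quot[of 1] unfolding ideal_power_1 .
  have add_P: "additive_subgroup P R" using maximal by (intro ideal.axioms(1) maximalideal.axioms(1))
  have sub_P: "abelian_subgroup P R" using add_P is_abelian_group by (rule abelian_subgroupI3)
  have rcos_self: "a \<in> P +> a" if "a \<in> carrier R" for a
    using abelian_subgroup.a_rcos_self[OF sub_P that] .
  have open_coset: "openin ?X (P +> a)" if "a \<in> carrier R" for a
    unfolding adic_topology_def
  proof (rule topology_generated_by_Basis, rule CollectI, intro exI conjI)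
    show "P +> a = ideal_power R P 1 +> a" unfolding ideal_power_1 ..
  qed (rule that)
  have top: "topspace ?X \<subseteq> carrier R"
  proof -
    have "ideal_power R P n +> a \<subseteq> carrier R" if "a \<in> carrier R" for n a
      using ideal.axioms(1)[OF ideal_ideal_power[of n]] that
      by (intro a_r_coset_subset_G additive_subgroup.a_subset)
    then show ?thesis unfolding adic_topology_def topology_generated_by_topspace by blast
  qed
  have "\<forall>U\<in>(+>) P ` carrier R. openin ?X U" by (intro ballI, elim imageE) (simp add: open_coset)
  moreover have "topspace ?X \<subseteq> \<Union>((+>) P ` carrier R)"
    using top rcos_self by blast
  ultimately obtain F where F: "finite F" "F \<subseteq> (+>) P ` carrier R" "topspace ?X \<subseteq> \<Union>F"
    using compact unfolding compact_space_alt by metis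
  have "(+>) P ` carrier R \<subseteq> F"
  proof (rule image_subsetI)
    fix a assume a: "a \<in> carrier R"
    then have "a \<in> topspace ?X" using openin_subset[OF open_coset] rcos_self by blast
    then obtain V where V: "V \<in> F" "a \<in> V" using F(3) by blast
    then obtain b where b: "b \<in> carrier R" "V = P +> b" using F(2) by blast
    have "P +> b = P +> a"
      using a_repr_independence[OF _ b(1) additive_subgroup.a_subgroup[OF add_P], of a] V(2) b(2) by simp
    then show "P +> a \<in> F" using b(2) V(1) by simp
  qed
  then show ?thesis unfolding C using F(1) by (rule finite_subset)
qed


section \<open>Action of symmetric relation matrices on a primitive vector\<close>

lemma admissible_not_closed:
  assumes "admissible d e C A" "I \<subseteq> {..<d}" "J \<subseteq> {..<e}" "I \<noteq> {}" "J \<noteq> {}"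
  obtains i j where "i \<in> I" "j \<in> J" "blank C A (i, j)"
  | c i j i' j' where "c \<in> C" "(i, j) \<in> A c" "(i', j') \<in> A c" "i \<in> I" "j \<in> J" "i' \<notin> I \<or> j' \<notin> J"
proof (cases "colour_closed C A (I \<times> J)")
  case True
  have "subgrid d e (I \<times> J)" "I \<times> J \<noteq> {}" using assms unfolding subgrid_def by blast+
  then obtain z where "z \<in> I \<times> J" "blank C A z" using assms(1) True unfolding admissible_def by blast
  then show ?thesis using that(1) by blast
next
  case False
  then obtain c z z' where "c \<in> C" "z \<in> A c" "z \<in> I \<times> J" "z' \<in> A c" "z' \<notin> I \<times> J"
    unfolding colour_closed_def by blast
  then show ?thesis using that(2)[of c "fst z" "snd z" "fst z'" "snd z'"] by (simp add: mem_Times_iff)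
qed

locale admissible_relations = uniformized_dvr R P p
  for R :: "('a, 'b) ring_scheme" (structure) and P p +
  fixes d e :: nat and C :: "'c set" and A :: "'c \<Rightarrow> (nat \<times> nat) set" and u :: "'a mat"
  assumes colouring: "partial_colouring d e C A"
    and u_carrier: "u \<in> carrier_mat d e"
    and u_Units: "elements_mat u \<subseteq> Units R"
    and admissible: "admissible d e C A"
begin

lemma cell: "c \<in> C \<Longrightarrow> z \<in> A c \<Longrightarrow> fst z < d \<and> snd z < e"
  using colouring unfolding partial_colouring_def by fastforce

lemma finite_colour: "c \<in> C \<Longrightarrow> finite (A c)"
  using colouring finite_subset[of "A c" "{..<d} \<times> {..<e}"] unfolding partial_colouring_def by blast

lemma colour_unique: "c \<in> C \<Longrightarrow> c' \<in> C \<Longrightarrow> z \<in> A c \<Longrightarrow> z \<in> A c' \<Longrightarrow> c = c'"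
  using colouring unfolding partial_colouring_def disjoint_family_on_def by blast

lemma u_unit: "i < d \<Longrightarrow> j < e \<Longrightarrow> u $$ (i, j) \<in> Units R"
  using u_Units elements_matI[OF u_carrier] by blast

lemma u_closed: "c \<in> C \<Longrightarrow> z \<in> A c \<Longrightarrow> u $$ z \<in> carrier R"
  using u_unit[of "fst z" "snd z"] cell[of c z] by (simp add: Units_closed)

section \<open>Symmetric relation matrices as entry functions\<close>

definition relation :: "'c \<Rightarrow> (nat \<times> nat \<Rightarrow> 'a) \<Rightarrow> 'a" where
  "relation c X = (\<Oplus>z\<in>A c. u $$ z \<otimes> X (fst z, d + snd z))"

text \<open>
  Matrices are represented by entry functions on all of \<^typ>\<open>nat \<times> nat\<close>, which avoids index bounds;
  the cell \<open>(i, j)\<close> of the off-diagonal block has index \<open>(i, d + j)\<close>.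
\<close>

definition srel :: "(nat \<times> nat \<Rightarrow> 'a) \<Rightarrow> bool" where
  "srel X \<longleftrightarrow> (\<forall>z. X z \<in> carrier R) \<and> (\<forall>i j. X (i, j) = X (j, i)) \<and> (\<forall>c\<in>C. relation c X = \<zero>)"

lemma relation_lincomb:
  assumes "c \<in> C" "\<And>z. X z \<in> carrier R" "\<And>z. Y z \<in> carrier R" "s \<in> carrier R"
  shows "relation c (\<lambda>z. X z \<oplus> s \<otimes> Y z) = relation c X \<oplus> s \<otimes> relation c Y"
proof -
  have "relation c (\<lambda>z. X z \<oplus> s \<otimes> Y z)
      = (\<Oplus>z\<in>A c. u $$ z \<otimes> X (fst z, d + snd z) \<oplus> s \<otimes> (u $$ z \<otimes> Y (fst z, d + snd z)))"
    unfolding relation_def using assms u_closed[OF assms(1)]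
    by (intro finsum_cong') (simp_all add: r_distr m_lcomm)
  also have "\<dots> = relation c X \<oplus> (\<Oplus>z\<in>A c. s \<otimes> (u $$ z \<otimes> Y (fst z, d + snd z)))"
    unfolding relation_def using assms u_closed[OF assms(1)] by (intro finsum_addf) simp_all
  also have "(\<Oplus>z\<in>A c. s \<otimes> (u $$ z \<otimes> Y (fst z, d + snd z))) = s \<otimes> relation c Y"
    unfolding relation_def using assms u_closed[OF assms(1)] finite_colour[OF assms(1)]
    by (intro finsum_rdistr[symmetric]) simp_all
  finally show ?thesis .
qed

text \<open>The one closure property behind sums (s = 1), differences (s = -1) and corrections by
  multiples of p^n (s = p^n).\<close>

lemma srel_lincomb:
  assumes "srel X" "srel Y" "s \<in> carrier R" shows "srel (\<lambda>z. X z \<oplus> s \<otimes> Y z)"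
  unfolding srel_def
proof (intro conjI allI ballI)
  have X: "\<And>z. X z \<in> carrier R" "\<And>z. Y z \<in> carrier R" using assms(1,2) unfolding srel_def by blast+
  fix c assume c: "c \<in> C"
  have "relation c X = \<zero>" "relation c Y = \<zero>" using assms(1,2) c unfolding srel_def by blast+
  then show "relation c (\<lambda>z. X z \<oplus> s \<otimes> Y z) = \<zero>" using relation_lincomb[OF c X assms(3)] assms(3) by simp
next
  fix z
  have X: "X z \<in> carrier R" "Y z \<in> carrier R" using assms(1,2) unfolding srel_def by blast+
  show "X z \<oplus> s \<otimes> Y z \<in> carrier R" using X assms(3) by simp
next
  fix i j
  have "X (i, j) = X (j, i)" "Y (i, j) = Y (j, i)" using assms(1,2) unfolding srel_def by blast+
  then show "X (i, j) \<oplus> s \<otimes> Y (i, j) = X (j, i) \<oplus> s \<otimes> Y (j, i)" by (simp only:)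
qed

lemma srel_zero: "srel (\<lambda>_. \<zero>)"
proof -
  have "relation c (\<lambda>_. \<zero>) = \<zero>" if "c \<in> C" for c
  proof -
    have "relation c (\<lambda>_. \<zero>) = (\<Oplus>z\<in>A c. \<zero>)"
      unfolding relation_def using u_closed[OF that] by (intro finsum_cong') simp_all
    then show ?thesis by simp
  qed
  then show ?thesis unfolding srel_def by simp
qed

text \<open>This is E_ab + E_ba for distinct a and b, but E_aa for a = b: the disjunction puts a one
  on the diagonal, not a two. Residue characteristic 2 thus needs no separate treatment.\<close>

definition elem :: "nat \<Rightarrow> nat \<Rightarrow> nat \<times> nat \<Rightarrow> 'a" where
  "elem a b z = (if z = (a, b) \<or> z = (b, a) then \<one> else \<zero>)"

lemma elem_closed [simp]: "elem a b z \<in> carrier R"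
  unfolding elem_def by simp

lemma elem_sym: "elem a b (i, j) = elem a b (j, i)"
  unfolding elem_def by auto

lemma relation_elem_same_block:
  assumes "c \<in> C" "(a < d \<and> b < d) \<or> (a \<ge> d \<and> b \<ge> d)"
  shows "relation c (elem a b) = \<zero>"
proof -
  have "relation c (elem a b) = (\<Oplus>z\<in>A c. \<zero>)"
    unfolding relation_def
  proof (intro finsum_cong' refl)
    fix z assume z: "z \<in> A c"
    have "elem a b (fst z, d + snd z) = \<zero>" using assms cell[OF assms(1) z] unfolding elem_def by auto
    then show "u $$ z \<otimes> elem a b (fst z, d + snd z) = \<zero>" using u_closed[OF assms(1) z] by simp
  qed simp
  then show ?thesis by simp
qed

lemma relation_elem_cross:
  assumes "c \<in> C" "i < d" "j < e"
  shows "relation c (elem i (d + j)) = (if (i, j) \<in> A c then u $$ (i, j) else \<zero>)"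
proof -
  have elem: "elem i (d + j) (fst z, d + snd z) = (if (i, j) = z then \<one> else \<zero>)" if "z \<in> A c" for z
    using assms cell[OF assms(1) that] unfolding elem_def by (cases z) auto
  show ?thesis
  proof (cases "(i, j) \<in> A c")
    case True
    have "relation c (elem i (d + j)) = (\<Oplus>z\<in>A c. if (i, j) = z then u $$ z else \<zero>)"
      unfolding relation_def using u_closed[OF assms(1)] by (intro finsum_cong') (simp_all add: elem)
    also have "\<dots> = u $$ (i, j)"
      using True finite_colour[OF assms(1)] u_closed[OF assms(1)] by (intro finsum_singleton) simp_all
    finally show ?thesis using True by simp
  next
    case False
    have "relation c (elem i (d + j)) = (\<Oplus>z\<in>A c. \<zero>)"
      unfolding relation_def
    proof (intro finsum_cong' refl)
      fix z assume z: "z \<in> A c"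
      then have "(i, j) \<noteq> z" using False by blast
      then show "u $$ z \<otimes> elem i (d + j) (fst z, d + snd z) = \<zero>" using elem[OF z] u_closed[OF assms(1) z] by simp
    qed simp
    then show ?thesis using False by simp
  qed
qed

lemma srel_elem_same_block:
  "(a < d \<and> b < d) \<or> (a \<ge> d \<and> b \<ge> d) \<Longrightarrow> srel (elem a b)"
  unfolding srel_def using relation_elem_same_block elem_sym elem_closed by blast

lemma srel_elem_blank:
  assumes "i < d" "j < e" "blank C A (i, j)" shows "srel (elem i (d + j))"
proof -
  have "relation c (elem i (d + j)) = \<zero>" if "c \<in> C" for c
    using relation_elem_cross[OF that assms(1,2)] assms(3) that unfolding blank_def by simp
  then show ?thesis unfolding srel_def using elem_sym elem_closed by blast
qed

text \<open>The inverse entries of \<open>u\<close> are chosen so that the two cells contribute 1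
  and -1 to the relation of their common colour. By disjointness neither cell occurs in the relation
  of another colour.\<close>

lemma srel_elem_colour:
  assumes c: "c \<in> C" "(i, j) \<in> A c" "(i', j') \<in> A c"
  shows "srel (\<lambda>z. inv (u $$ (i, j)) \<otimes> elem i (d + j) z \<oplus> (\<ominus> (inv (u $$ (i', j')))) \<otimes> elem i' (d + j') z)"
    (is "srel ?X")
proof -
  have lt: "i < d" "j < e" "i' < d" "j' < e" using cell[OF c(1,2)] cell[OF c(1,3)] by simp_all
  have un: "u $$ (i, j) \<in> Units R" "u $$ (i', j') \<in> Units R" using u_unit lt by blast+
  have cl: "inv (u $$ (i, j)) \<in> carrier R" "inv (u $$ (i', j')) \<in> carrier R" using un by simp_all
  have rel: "relation c' ?X = \<zero>" if c': "c' \<in> C" for c'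
  proof -
    have "relation c' (\<lambda>z. \<zero> \<oplus> inv (u $$ (i, j)) \<otimes> elem i (d + j) z)
        = \<zero> \<oplus> inv (u $$ (i, j)) \<otimes> relation c' (elem i (d + j))"
      using relation_lincomb[OF c', of "\<lambda>_. \<zero>" "elem i (d + j)"] cl srel_zero c' unfolding srel_def by simp
    moreover have "relation c' (elem i'' j'') \<in> carrier R" for i'' j''
      unfolding relation_def using u_closed[OF c'] by (intro finsum_closed) simp
    ultimately have 1: "relation c' (\<lambda>z. inv (u $$ (i, j)) \<otimes> elem i (d + j) z)
        = inv (u $$ (i, j)) \<otimes> relation c' (elem i (d + j))"
      using cl by simp
    have 2: "relation c' ?X = inv (u $$ (i, j)) \<otimes> relation c' (elem i (d + j))
        \<oplus> (\<ominus> (inv (u $$ (i', j')))) \<otimes> relation c' (elem i' (d + j'))"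
      unfolding 1[symmetric] using cl by (intro relation_lincomb[OF c']) simp_all
    show ?thesis
    proof (cases "c' = c")
      case True
      then show ?thesis unfolding 2 using c un cl lt relation_elem_cross[OF c']
        by (simp add: l_minus r_neg Units_closed)
    next
      case False
      then have "(i, j) \<notin> A c'" "(i', j') \<notin> A c'" using colour_unique[OF c(1) c'] c by blast+
      then show ?thesis unfolding 2 using cl lt relation_elem_cross[OF c'] by simp
    qed
  qed
  have sym: "?X (i, j) = ?X (j, i)" for i j
    using elem_sym by metis
  have "?X z \<in> carrier R" for z using cl by simp
  then show ?thesis unfolding srel_def using rel sym by blast
qed

section \<open>Products of a row vector with symmetric relation matrices\<close>

definition act :: "(nat \<Rightarrow> 'a) \<Rightarrow> (nat \<times> nat \<Rightarrow> 'a) \<Rightarrow> nat \<Rightarrow> 'a" where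
  "act y X j = (\<Oplus>i\<in>{..<d + e}. y i \<otimes> X (i, j))"

lemma act_closed [simp]:
  "(\<And>i. y i \<in> carrier R) \<Longrightarrow> (\<And>z. X z \<in> carrier R) \<Longrightarrow> act y X j \<in> carrier R"
  unfolding act_def by (intro finsum_closed) simp

lemma act_lincomb:
  assumes "\<And>i. y i \<in> carrier R" "\<And>z. X z \<in> carrier R" "\<And>z. Y z \<in> carrier R" "s \<in> carrier R"
  shows "act y (\<lambda>z. X z \<oplus> s \<otimes> Y z) j = act y X j \<oplus> s \<otimes> act y Y j"
proof -
  have "act y (\<lambda>z. X z \<oplus> s \<otimes> Y z) j = (\<Oplus>i\<in>{..<d + e}. y i \<otimes> X (i, j) \<oplus> s \<otimes> (y i \<otimes> Y (i, j)))"
    unfolding act_def using assms by (intro finsum_cong') (simp_all add: r_distr m_lcomm)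
  also have "\<dots> = act y X j \<oplus> (\<Oplus>i\<in>{..<d + e}. s \<otimes> (y i \<otimes> Y (i, j)))"
    unfolding act_def using assms by (intro finsum_addf) simp_all
  also have "(\<Oplus>i\<in>{..<d + e}. s \<otimes> (y i \<otimes> Y (i, j))) = s \<otimes> act y Y j"
    unfolding act_def using assms by (intro finsum_rdistr[symmetric]) simp_all
  finally show ?thesis .
qed

lemma act_elem:
  assumes y: "\<And>i. y i \<in> carrier R" and ab: "a < d + e" "b < d + e"
  shows "act y (elem a b) j = (if j = b then y a else if j = a then y b else \<zero>)"
proof -
  have single: "(\<Oplus>i\<in>{..<d + e}. if k = i then y i else \<zero>) = y k" if "k < d + e" for k
    using that y by (intro finsum_singleton) simp_all
  consider "j = b" | "j = a" "j \<noteq> b" | "j \<noteq> a" "j \<noteq> b" by blast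
  then show ?thesis
  proof cases
    case 1
    have "act y (elem a b) j = (\<Oplus>i\<in>{..<d + e}. if a = i then y i else \<zero>)"
      unfolding act_def using y 1 by (intro finsum_cong') (auto simp: elem_def)
    then show ?thesis using single[OF ab(1)] 1 by simp
  next
    case 2
    have "act y (elem a b) j = (\<Oplus>i\<in>{..<d + e}. if b = i then y i else \<zero>)"
      unfolding act_def using y 2 by (intro finsum_cong') (auto simp: elem_def)
    then show ?thesis using single[OF ab(2)] 2 by simp
  next
    case 3
    have "act y (elem a b) j = (\<Oplus>i\<in>{..<d + e}. \<zero>)"
      unfolding act_def using y 3 by (intro finsum_cong') (auto simp: elem_def)
    then show ?thesis using 3 by simp
  qed
qed

end

text \<open>Stated for arbitrary ring elements so that they can be instantiated with the sums in
  \<open>act\<close> and the values of \<open>delta\<close> as opaque terms.\<close>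

lemma (in cring) lincomb_identities:
  assumes "a \<in> carrier R" "b \<in> carrier R" "c \<in> carrier R" "f \<in> carrier R" "s \<in> carrier R"
  shows "(a \<oplus> s \<otimes> b) \<ominus> (c \<oplus> s \<otimes> f) = (a \<ominus> c) \<oplus> s \<otimes> (b \<ominus> f)"
    and "(a \<ominus> b) \<oplus> (b \<ominus> c) = a \<ominus> c"
    and "a \<ominus> (b \<oplus> c) = (a \<ominus> b) \<ominus> c"
    and "(a \<oplus> b) \<oplus> \<ominus> \<one> \<otimes> b = a"
    and "s \<otimes> (a \<otimes> b \<oplus> c) \<oplus> f = (s \<otimes> a) \<otimes> b \<oplus> (f \<oplus> s \<otimes> c)"
  using assms by algebra+

context admissible_relations
begin

lemma act_smult:
  assumes "\<And>i. y i \<in> carrier R" "\<And>z. Y z \<in> carrier R" "s \<in> carrier R"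
  shows "act y (\<lambda>z. s \<otimes> Y z) j = s \<otimes> act y Y j"
proof -
  have "act y (\<lambda>z. s \<otimes> Y z) j = (\<Oplus>i\<in>{..<d + e}. s \<otimes> (y i \<otimes> Y (i, j)))"
    unfolding act_def using assms by (intro finsum_cong') (simp_all add: m_lcomm)
  also have "\<dots> = s \<otimes> act y Y j"
    unfolding act_def using assms by (intro finsum_rdistr[symmetric]) simp_all
  finally show ?thesis .
qed

lemma act_zero:
  assumes "\<And>i. y i \<in> carrier R" shows "act y (\<lambda>_. \<zero>) j = \<zero>"
  using act_smult[of y "\<lambda>_. \<zero>" \<zero> j] assms by simp

definition delta :: "nat \<Rightarrow> nat \<Rightarrow> 'a" where
  "delta k j = (if j = k then \<one> else \<zero>)"

lemma delta_closed [simp]: "delta k j \<in> carrier R"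
  unfolding delta_def by simp

text \<open>The vectors \<open>v\<close> whose first \<open>d + e\<close> entries agree modulo \<open>P\<close> with \<open>y X\<close> for some \<open>X\<close> in \<open>SRel\<close>.\<close>

definition reach :: "(nat \<Rightarrow> 'a) \<Rightarrow> (nat \<Rightarrow> 'a) \<Rightarrow> bool" where
  "reach y v \<longleftrightarrow> (\<forall>j. v j \<in> carrier R) \<and> (\<exists>X. srel X \<and> (\<forall>j<d + e. v j \<ominus> act y X j \<in> P))"

lemma P_ideal: "ideal P R"
  using maximal by (rule maximalideal.axioms)

lemma P_zero: "\<zero> \<in> P"
  by (rule additive_subgroup.zero_closed[OF ideal.axioms(1)[OF P_ideal]])

lemma P_add: "a \<in> P \<Longrightarrow> b \<in> P \<Longrightarrow> a \<oplus> b \<in> P"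
  by (rule additive_subgroup.a_closed[OF ideal.axioms(1)[OF P_ideal]])

context
  fixes y :: "nat \<Rightarrow> 'a"
  assumes y: "\<And>i. y i \<in> carrier R"
begin

lemma reach_closed: "reach y v \<Longrightarrow> v j \<in> carrier R"
  unfolding reach_def by blast

lemma reach_act:
  assumes "srel X" shows "reach y (act y X)"
proof -
  have "\<And>z. X z \<in> carrier R" using assms unfolding srel_def by blast
  then have "act y X j \<in> carrier R" for j using y by simp
  then have "act y X j \<in> carrier R" "act y X j \<ominus> act y X j \<in> P" for j using P_zero by (simp_all add: r_neg a_minus_def)
  then show ?thesis unfolding reach_def using assms by blast
qed

lemma reach_lincomb:
  assumes "reach y v" "reach y w" "s \<in> carrier R" shows "reach y (\<lambda>j. v j \<oplus> s \<otimes> w j)"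
proof -
  obtain X where X: "srel X" "\<And>j. j < d + e \<Longrightarrow> v j \<ominus> act y X j \<in> P"
    using assms(1) unfolding reach_def by blast
  obtain Y where Y: "srel Y" "\<And>j. j < d + e \<Longrightarrow> w j \<ominus> act y Y j \<in> P"
    using assms(2) unfolding reach_def by blast
  have cl: "\<And>z. X z \<in> carrier R" "\<And>z. Y z \<in> carrier R" using X(1) Y(1) unfolding srel_def by blast+
  have vw: "v j \<in> carrier R" "w j \<in> carrier R" for j using assms(1,2) reach_closed by blast+
  have "(v j \<oplus> s \<otimes> w j) \<ominus> act y (\<lambda>z. X z \<oplus> s \<otimes> Y z) j \<in> P" if j: "j < d + e" for j
  proof -
    have "(v j \<oplus> s \<otimes> w j) \<ominus> act y (\<lambda>z. X z \<oplus> s \<otimes> Y z) j = (v j \<ominus> act y X j) \<oplus> s \<otimes> (w j \<ominus> act y Y j)"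
      unfolding act_lincomb[OF y cl assms(3)] using vw cl y assms(3)
      by (intro lincomb_identities(1)) simp_all
    then show ?thesis
      using P_add[OF X(2)[OF j] ideal.I_l_closed[OF P_ideal Y(2)[OF j] assms(3)]] by simp
  qed
  then show ?thesis unfolding reach_def using srel_lincomb[OF X(1) Y(1) assms(3)] vw assms(3) by blast
qed

lemma reach_cong:
  assumes "reach y v" "\<And>j. w j \<in> carrier R" "\<And>j. j < d + e \<Longrightarrow> w j \<ominus> v j \<in> P" shows "reach y w"
proof -
  obtain X where X: "srel X" "\<And>j. j < d + e \<Longrightarrow> v j \<ominus> act y X j \<in> P"
    using assms(1) unfolding reach_def by blast
  have cl: "\<And>z. X z \<in> carrier R" using X(1) unfolding srel_def by blast
  have "w j \<ominus> act y X j \<in> P" if j: "j < d + e" for j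
  proof -
    have "(w j \<ominus> v j) \<oplus> (v j \<ominus> act y X j) = w j \<ominus> act y X j"
      using reach_closed[OF assms(1)] assms(2) y cl by (intro lincomb_identities(2)) simp_all
    then show ?thesis using P_add[OF assms(3)[OF j] X(2)[OF j]] by simp
  qed
  then show ?thesis unfolding reach_def using assms(2) X(1) by blast
qed

lemma reach_eq:
  assumes "reach y v" "\<And>j. w j \<in> carrier R" "\<And>j. j < d + e \<Longrightarrow> w j = v j" shows "reach y w"
proof (rule reach_cong[OF assms(1,2)])
  fix j assume "j < d + e"
  then have "w j = v j" by (rule assms(3))
  then show "w j \<ominus> v j \<in> P" using reach_closed[OF assms(1)] P_zero by (simp add: r_neg a_minus_def)
qed

lemma reach_zero: "reach y (\<lambda>_. \<zero>)"
  using reach_act[OF srel_zero] by (rule reach_eq) (simp_all add: act_zero[OF y])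

lemma reach_smult:
  assumes "reach y v" "s \<in> carrier R" shows "reach y (\<lambda>j. s \<otimes> v j)"
  using reach_lincomb[OF reach_zero assms] by (rule reach_eq) (simp_all add: reach_closed[OF assms(1)] assms(2))

text \<open>The two ways in which an unwanted term y_b e_a can be discarded: the vector e_a is
  already available, or the coefficient vanishes modulo \<open>P\<close>.\<close>

lemma reach_delta_multiple:
  assumes "reach y (delta a) \<or> y b \<in> P" shows "reach y (\<lambda>j. y b \<otimes> delta a j)"
  using assms
proof
  assume "reach y (delta a)" then show ?thesis using y by (rule reach_smult)
next
  assume b: "y b \<in> P"
  have "y b \<otimes> delta a j \<ominus> \<zero> \<in> P" for j
    using ideal.I_r_closed[OF P_ideal b delta_closed[of a j]] y by (simp add: a_minus_def)
  then show ?thesis using reach_cong[OF reach_zero, of "\<lambda>j. y b \<otimes> delta a j"] y by simp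
qed

text \<open>The elimination step: the part r that is already reached is subtracted, and the
  remaining coefficient t is inverted.\<close>

lemma reach_delta_cancel:
  assumes "reach y v" "reach y r" "t \<in> Units R" "\<And>j. j < d + e \<Longrightarrow> v j = t \<otimes> delta b j \<oplus> r j"
  shows "reach y (delta b)"
proof -
  have t: "t \<in> carrier R" "inv t \<in> carrier R" "inv t \<otimes> t = \<one>" using assms(3) by (simp_all add: Units_closed)
  have "reach y (\<lambda>j. inv t \<otimes> (v j \<oplus> \<ominus> \<one> \<otimes> r j))"
    using t by (intro reach_smult reach_lincomb assms(1,2)) simp_all
  then show ?thesis
  proof (rule reach_eq)
    fix j assume j: "j < d + e"
    have "(t \<otimes> delta b j \<oplus> r j) \<oplus> \<ominus> \<one> \<otimes> r j = t \<otimes> delta b j"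
      using t reach_closed[OF assms(2)] by (intro lincomb_identities(4)) simp_all
    then have "inv t \<otimes> (v j \<oplus> \<ominus> \<one> \<otimes> r j) = inv t \<otimes> (t \<otimes> delta b j)" using assms(4)[OF j] by simp
    also have "\<dots> = delta b j" using t by (simp flip: m_assoc)
    finally show "delta b j = inv t \<otimes> (v j \<oplus> \<ominus> \<one> \<otimes> r j)" by simp
  qed simp
qed

lemma act_elem_delta:
  assumes "a < d + e" "b < d + e" "a \<noteq> b"
  shows "act y (elem a b) j = y a \<otimes> delta b j \<oplus> y b \<otimes> delta a j"
  unfolding act_elem[OF y assms(1,2)] delta_def using assms(3) y by simp

lemma elem_commute: "elem a b = elem b a"
  unfolding elem_def by (rule ext) auto

text \<open>Here y (E_ab + E_ba) = y_a e_b + y_b e_a, where y_a is invertible and the second term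
  can be discarded.\<close>

lemma reach_delta_elem:
  assumes "a < d + e" "b < d + e" "a \<noteq> b" "srel (elem a b)" "y a \<in> Units R" "reach y (delta a) \<or> y b \<in> P"
  shows "reach y (delta b)"
  using reach_act[OF assms(4)] reach_delta_multiple[OF assms(6)] assms(5)
  by (rule reach_delta_cancel) (rule act_elem_delta[OF assms(1-3)])

lemma reach_delta_diag:
  assumes "k < d + e" "y k \<in> Units R" shows "reach y (delta k)"
proof -
  have "srel (elem k k)" by (rule srel_elem_same_block) linarith
  then show ?thesis
    using reach_zero assms(2)
    by (rule reach_delta_cancel[OF reach_act]) (use y assms(1) in \<open>simp add: act_elem delta_def\<close>)
qed

lemma reach_delta_same_block:
  assumes "a < d + e" "b < d + e" "(a < d \<and> b < d) \<or> (a \<ge> d \<and> b \<ge> d)" "y a \<in> Units R"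
  shows "reach y (delta b)"
proof (cases "a = b")
  case True
  then show ?thesis using reach_delta_diag assms(1,4) by blast
next
  case False
  then show ?thesis
    using reach_delta_elem[OF assms(1,2) _ srel_elem_same_block[OF assms(3)] assms(4)]
      reach_delta_diag[OF assms(1,4)] by blast
qed

text \<open>The product with y is s (y_a e_b + y_b e_a) + s' (y_a' e_b' + y_b' e_a'). The three
  alternatives in \<open>r\<close> dispose of every term except s y_a e_b, whose coefficient is a
  unit. In the application a and a' lie in the block that contains the unit entry, b and b' in the
  other block.\<close>

lemma reach_delta_colour:
  assumes X: "srel (\<lambda>z. s \<otimes> elem a b z \<oplus> s' \<otimes> elem a' b' z)"
    and ab: "a < d + e" "b < d + e" "a \<noteq> b" and ab': "a' < d + e" "b' < d + e" "a' \<noteq> b'"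
    and s: "s \<in> Units R" "s' \<in> carrier R" and a: "y a \<in> Units R"
    and r: "reach y (delta a) \<or> y b \<in> P"
      "reach y (delta a') \<or> y b' \<in> P" "reach y (delta b') \<or> y a' \<in> P"
  shows "reach y (delta b)"
proof -
  let ?f = "\<lambda>j. y a' \<otimes> delta b' j \<oplus> y b' \<otimes> delta a' j"
  have sc: "s \<in> carrier R" using s(1) by (rule Units_closed)
  have f: "reach y ?f"
  proof (rule reach_eq)
    show "reach y (\<lambda>j. y a' \<otimes> delta b' j \<oplus> \<one> \<otimes> (y b' \<otimes> delta a' j))"
      using reach_delta_multiple r(2,3) by (intro reach_lincomb) blast+
  qed (use y in simp_all)
  have "reach y (\<lambda>j. s' \<otimes> ?f j \<oplus> s \<otimes> (y b \<otimes> delta a j))"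
    using reach_smult[OF f s(2)] reach_delta_multiple[OF r(1)] sc by (rule reach_lincomb)
  moreover have "s \<otimes> y a \<in> Units R" using s(1) a by simp
  ultimately show ?thesis
  proof (rule reach_delta_cancel[OF reach_act[OF X]])
    fix j
    have "act y (\<lambda>z. s \<otimes> elem a b z \<oplus> s' \<otimes> elem a' b' z) j = s \<otimes> act y (elem a b) j \<oplus> s' \<otimes> act y (elem a' b') j"
      using act_lincomb[of y "\<lambda>z. s \<otimes> elem a b z" "elem a' b'" s' j] y sc s(2)
      by (simp add: act_smult)
    also have "\<dots> = s \<otimes> (y a \<otimes> delta b j \<oplus> y b \<otimes> delta a j) \<oplus> s' \<otimes> ?f j"
      unfolding act_elem_delta[OF ab] act_elem_delta[OF ab'] ..
    also have "\<dots> = (s \<otimes> y a) \<otimes> delta b j \<oplus> (s' \<otimes> ?f j \<oplus> s \<otimes> (y b \<otimes> delta a j))"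
      using y sc s(2) by (intro lincomb_identities(5)) simp_all
    finally show "act y (\<lambda>z. s \<otimes> elem a b z \<oplus> s' \<otimes> elem a' b' z) j
        = (s \<otimes> y a) \<otimes> delta b j \<oplus> (s' \<otimes> ?f j \<oplus> s \<otimes> (y b \<otimes> delta a j))" .
  qed
qed

lemma nonunit_in_P: "y k \<notin> Units R \<Longrightarrow> y k \<in> P"
  using nonunit_in_maximal_ideal y by blast

lemma inv_u: "i < d \<Longrightarrow> j < e \<Longrightarrow> inv (u $$ (i, j)) \<in> Units R"
  using u_unit by simp

lemma minus_inv_u: "i < d \<Longrightarrow> j < e \<Longrightarrow> \<ominus> (inv (u $$ (i, j))) \<in> carrier R"
  using u_unit by simp

text \<open>The block with the unit entry is reached through its symmetric diagonal block. The other
  one is handled by contradiction, with admissibility applied to the rows and columns still causing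
  trouble. The two cases are transposes of each other.\<close>

lemma reach_delta:
  assumes k: "k < d + e" "y k \<in> Units R" and b: "b < d + e"
  shows "reach y (delta b)"
proof (cases "k < d")
  case True
  have block: "reach y (delta i)" if "i < d" for i
    using reach_delta_same_block[OF k(1) _ _ k(2), of i] that True by simp
  let ?I = "{i. i < d \<and> y i \<in> Units R}" and ?J = "{j. j < e \<and> \<not> reach y (delta (d + j))}"
  have "?J = {}"
  proof (rule ccontr)
    assume J: "?J \<noteq> {}"
    have I: "?I \<noteq> {}" using k True by blast
    show False
    proof (rule admissible_not_closed[OF admissible _ _ I J])
      fix i j assume ij: "i \<in> ?I" "j \<in> ?J" "blank C A (i, j)"
      then have "reach y (delta (d + j))"
        using block[of i] by (intro reach_delta_elem[of i "d + j"] srel_elem_blank) simp_all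
      then show False using ij(2) by blast
    next
      fix c i j i' j'
      assume c: "c \<in> C" "(i, j) \<in> A c" "(i', j') \<in> A c" and ij: "i \<in> ?I" "j \<in> ?J" and out: "i' \<notin> ?I \<or> j' \<notin> ?J"
      have lt: "i < d" "j < e" "i' < d" "j' < e" using cell[OF c(1,2)] cell[OF c(1,3)] by simp_all
      \<comment> \<open>This is what lying outside the subgrid gives: either j' is not missing, or
        i' is not a unit position and y_i' vanishes modulo \<open>P\<close>.\<close>
      have "reach y (delta (d + j'))  \<or> y i' \<in> P"
        using out lt nonunit_in_P[of i'] by blast
      then have "reach y (delta (d + j))"
        using lt ij block inv_u minus_inv_u
        by (intro reach_delta_colour[OF srel_elem_colour[OF c]]) simp_all
      then show False using ij(2) by blast
    qed blast+
  qed
  then have "reach y (delta (d + j))" if "j < e" for j using that by blast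
  from this[of "b - d"] show ?thesis using block[of b] b by (cases "b < d") simp_all
next
  case False
  have block: "reach y (delta (d + j))" if "j < e" for j
    using reach_delta_same_block[OF k(1) _ _ k(2), of "d + j"] that False by simp
  let ?I = "{i. i < d \<and> \<not> reach y (delta i)}" and ?J = "{j. j < e \<and> y (d + j) \<in> Units R}"
  have "?I = {}"
  proof (rule ccontr)
    assume I: "?I \<noteq> {}"
    have "k - d \<in> ?J" using k False by simp
    then have J: "?J \<noteq> {}" by blast
    show False
    proof (rule admissible_not_closed[OF admissible _ _ I J])
      fix i j assume ij: "i \<in> ?I" "j \<in> ?J" "blank C A (i, j)"
      then have "srel (elem (d + j) i)" using srel_elem_blank[of i j] elem_commute by simp
      then have "reach y (delta i)"
        using ij block[of j] by (intro reach_delta_elem[of "d + j" i]) simp_all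
      then show False using ij(1) by blast
    next
      fix c i j i' j'
      assume c: "c \<in> C" "(i, j) \<in> A c" "(i', j') \<in> A c" and ij: "i \<in> ?I" "j \<in> ?J" and out: "i' \<notin> ?I \<or> j' \<notin> ?J"
      have lt: "i < d" "j < e" "i' < d" "j' < e" using cell[OF c(1,2)] cell[OF c(1,3)] by simp_all
      have "reach y (delta i') \<or> y (d + j') \<in> P"
        using out lt nonunit_in_P[of "d + j'"] by blast
      \<comment> \<open>The matrix is the same, but its indices are exchanged so that the first one
        lies in the block of the unit entry, as \<open>reach_delta_colour\<close> expects.\<close>
      moreover have "srel (\<lambda>z. inv (u $$ (i, j)) \<otimes> elem (d + j) i z \<oplus> (\<ominus> (inv (u $$ (i', j')))) \<otimes> elem (d + j') i' z)"
        using srel_elem_colour[OF c] unfolding elem_commute[of _ "d + _"] .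
      ultimately have "reach y (delta i)"
        using lt ij block inv_u minus_inv_u
        by (intro reach_delta_colour[of "inv (u $$ (i, j))" "d + j" i "\<ominus> (inv (u $$ (i', j')))" "d + j'" i']) simp_all
      then show False using ij(1) by blast
    qed blast+
  qed
  then have "reach y (delta i)" if "i < d" for i using that by blast
  from this[of b] show ?thesis using block[of "b - d"] b by (cases "b < d") simp_all
qed

lemma reach_all:
  assumes k: "k < d + e" "y k \<in> Units R" and v: "\<And>j. v j \<in> carrier R"
  shows "reach y v"
proof -
  have "reach y (\<lambda>j. if j < l then v j else \<zero>)" if "l \<le> d + e" for l
    using that
  proof (induction l)
    case 0
    then show ?case using reach_zero by simp
  next
    case (Suc l)
    have "reach y (\<lambda>j. (if j < l then v j else \<zero>) \<oplus> v l \<otimes> delta l j)"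
      using Suc reach_delta[OF k, of l] v by (intro reach_lincomb) simp_all
    then show ?case
      by (rule reach_eq) (use v in \<open>simp_all add: delta_def less_Suc_eq\<close>)
  qed
  from this[OF order_refl] show ?thesis by (rule reach_eq) (simp_all add: v)
qed

lemma act_onto_mod_power:
  assumes k: "k < d + e" "y k \<in> Units R" and v: "\<And>j. v j \<in> carrier R"
  shows "\<exists>X. srel X \<and> (\<forall>j<d + e. v j \<ominus> act y X j \<in> ideal_power R P n)"
proof (induction n)
  case 0
  have "v j \<ominus> act y (\<lambda>_. \<zero>) j \<in> ideal_power R P 0" for j
    using v act_zero[OF y] by (simp add: ideal_power_0)
  then show ?case using srel_zero by blast
next
  case (Suc n)
  then obtain X where X: "srel X" "\<And>j. j < d + e \<Longrightarrow> v j \<ominus> act y X j \<in> ideal_power R P n" by blast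
  \<comment> \<open>Beyond index d + e any ring element serves as a filler, since
    \<open>reach_all\<close> asks for membership in the carrier at all indices.\<close>
  have "\<exists>b. b \<in> carrier R \<and> (j < d + e \<longrightarrow> v j \<ominus> act y X j = p [^] n \<otimes> b)" for j
  proof (cases "j < d + e")
    case True
    from X(2)[OF this] show ?thesis unfolding ideal_power_iff by blast
  qed (use zero_closed in blast)
  then have "\<exists>w. \<forall>j. w j \<in> carrier R \<and> (j < d + e \<longrightarrow> v j \<ominus> act y X j = p [^] n \<otimes> w j)"
    by (intro choice allI)
  then obtain w where w: "\<And>j. w j \<in> carrier R"
      "\<And>j. j < d + e \<Longrightarrow> v j \<ominus> act y X j = p [^] n \<otimes> w j"
    by blast
  \<comment> \<open>Nakayama: the error \<open>p^n w\<close> of \<open>X\<close> is removed modulo \<open>P^(n+1)\<close> by a solution \<open>Y\<close> for \<open>w\<close> modulo \<open>P\<close>.\<close>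
  obtain Y where Y: "srel Y" "\<And>j. j < d + e \<Longrightarrow> w j \<ominus> act y Y j \<in> P"
    using reach_all[of k w, OF k w(1)] unfolding reach_def by blast
  have cl: "\<And>z. X z \<in> carrier R" "\<And>z. Y z \<in> carrier R" using X(1) Y(1) unfolding srel_def by blast+
  have "v j \<ominus> act y (\<lambda>z. X z \<oplus> p [^] n \<otimes> Y z) j \<in> ideal_power R P (Suc n)" if j: "j < d + e" for j
  proof -
    have a: "act y X j \<in> carrier R" "act y Y j \<in> carrier R" using cl y by simp_all
    have "v j \<ominus> act y (\<lambda>z. X z \<oplus> p [^] n \<otimes> Y z) j = v j \<ominus> (act y X j \<oplus> p [^] n \<otimes> act y Y j)"
      using act_lincomb[of y X Y "p [^] n" j] y cl by simp
    also have "\<dots> = (v j \<ominus> act y X j) \<ominus> p [^] n \<otimes> act y Y j"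
      using v a by (intro lincomb_identities(3)[of _ _ _ \<zero> \<zero>]) simp_all
    also have "\<dots> = p [^] n \<otimes> (w j \<ominus> act y Y j)"
      unfolding w(2)[OF j] using w(1) a by (simp add: a_minus_def r_distr r_minus)
    finally have eq: "v j \<ominus> act y (\<lambda>z. X z \<oplus> p [^] n \<otimes> Y z) j = p [^] n \<otimes> (w j \<ominus> act y Y j)" .
    have "w j \<ominus> act y Y j \<in> carrier R" using w(1) a by simp
    moreover have "w j \<ominus> act y Y j \<in> ideal_power R P (Suc n - n)"
      using Y(2)[OF j] ideal_power_1 by simp
    ultimately show ?thesis unfolding eq by (subst p_pow_mult_in_ideal_power_iff) simp_all
  qed
  then have "\<forall>j<d + e. v j \<ominus> act y (\<lambda>z. X z \<oplus> p [^] n \<otimes> Y z) j \<in> ideal_power R P (Suc n)"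
    by (intro allI impI)
  moreover have "srel (\<lambda>z. X z \<oplus> p [^] n \<otimes> Y z)"
    using X(1) Y(1) nat_pow_closed[OF p_closed] by (rule srel_lincomb)
  ultimately show ?case by blast
qed

end

section \<open>Translation between entry functions and block matrices\<close>

lemma srel_of_four_block:
  assumes a: "a \<in> sym_mats R d" and b: "b \<in> sym_mats R e" and x: "x \<in> Rel_mats R d e C A u"
  obtains X where "srel X" "four_block_mat a x (transpose_mat x) b = mat (d + e) (d + e) X"
proof -
  let ?M = "four_block_mat a x (transpose_mat x) b"
  \<comment> \<open>The value zero outside the matrix makes membership in the carrier and symmetry
    hold at all indices, as \<open>srel\<close> demands.\<close>
  define X where "X = (\<lambda>(i, j). if i < d + e \<and> j < d + e then ?M $$ (i, j) else \<zero>)"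
  have am: "dim_row a = d" "dim_col a = d" "\<And>i j. i < d \<Longrightarrow> j < d \<Longrightarrow> a $$ (i, j) \<in> carrier R"
    using a unfolding sym_mats_def mats_iff by simp_all
  have bm: "dim_row b = e" "dim_col b = e" "\<And>i j. i < e \<Longrightarrow> j < e \<Longrightarrow> b $$ (i, j) \<in> carrier R"
    using b unfolding sym_mats_def mats_iff by simp_all
  have xm: "dim_row x = d" "dim_col x = e" "\<And>i j. i < d \<Longrightarrow> j < e \<Longrightarrow> x $$ (i, j) \<in> carrier R"
    and xr: "\<And>c. c \<in> C \<Longrightarrow> (\<Oplus>z\<in>A c. u $$ z \<otimes> x $$ z) = \<zero>"
    using x unfolding Rel_mats_def mats_iff by simp_all
  have "transpose_mat a = a" "transpose_mat b = b" using a b unfolding sym_mats_def by simp_all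
  then have asym: "a $$ (i, j) = a $$ (j, i)" if "i < d" "j < d" for i j
    using that am(1,2) index_transpose_mat(1)[of i a j] by simp
  have bsym: "b $$ (i, j) = b $$ (j, i)" if "i < e" "j < e" for i j
    using \<open>transpose_mat b = b\<close> that bm(1,2) index_transpose_mat(1)[of i b j] by simp
  have M: "?M $$ (i, j) = (if i < d then if j < d then a $$ (i, j) else x $$ (i, j - d)
      else if j < d then x $$ (j, i - d) else b $$ (i - d, j - d))" if "i < d + e" "j < d + e" for i j
  proof -
    have dims: "i < dim_row a + dim_row b" "j < dim_col a + dim_col b" using that am bm by simp_all
    show ?thesis using index_mat_four_block(1)[OF dims] am(1,2) xm(1,2) that by simp
  qed
  have "srel X"
    unfolding srel_def
  proof (intro conjI allI ballI)
    fix z :: "nat \<times> nat"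
    obtain i j where z: "z = (i, j)" by (rule prod.exhaust)
    have "?M $$ (i, j) \<in> carrier R" if "i < d + e" "j < d + e"
      unfolding M[OF that] using that am(3) bm(3) xm(3) by simp
    then show "X z \<in> carrier R" unfolding X_def z by simp
  next
    fix i j
    have "?M $$ (i, j) = ?M $$ (j, i)" if "i < d + e" "j < d + e"
      unfolding M[OF that] M[OF that(2,1)] using that asym[of i j] bsym[of "i - d" "j - d"] by simp
    then show "X (i, j) = X (j, i)" unfolding X_def by simp
  next
    fix c assume c: "c \<in> C"
    have "relation c X = (\<Oplus>z\<in>A c. u $$ z \<otimes> x $$ z)"
      unfolding relation_def
    proof (intro finsum_cong' refl)
      fix z assume z: "z \<in> A c"
      have "fst z < d" "snd z < e" using cell[OF c z] by simp_all
      then show "u $$ z \<otimes> X (fst z, d + snd z) = u $$ z \<otimes> x $$ z"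
        unfolding X_def by (simp add: M)
    next
      show "(\<lambda>z. u $$ z \<otimes> x $$ z) \<in> A c \<rightarrow> carrier R"
      proof
        fix z assume z: "z \<in> A c"
        have "x $$ z \<in> carrier R" using cell[OF c z] xm(3)[of "fst z" "snd z"] by simp
        then show "u $$ z \<otimes> x $$ z \<in> carrier R" using u_closed[OF c z] by simp
      qed
    qed
    then show "relation c X = \<zero>" using xr[OF c] by simp
  qed
  moreover have "?M = mat (d + e) (d + e) X"
    using am(1,2) bm(1,2) by (intro eq_matI) (simp_all add: X_def)
  ultimately show ?thesis by (rule that)
qed

lemma four_block_of_srel:
  assumes "srel X" shows "mat (d + e) (d + e) X \<in> SRel_mats R d e C A u"
proof -
  have cl: "\<And>z. X z \<in> carrier R" and sym: "\<And>i j. X (i, j) = X (j, i)"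
    and rel: "\<And>c. c \<in> C \<Longrightarrow> relation c X = \<zero>"
    using assms unfolding srel_def by blast+
  let ?a = "mat d d X" and ?x = "mat d e (\<lambda>(i, j). X (i, d + j))" and ?b = "mat e e (\<lambda>(i, j). X (d + i, d + j))"
  have "?a \<in> sym_mats R d" "?b \<in> sym_mats R e"
    unfolding sym_mats_def mats_iff using cl sym by (auto simp del: split_paired_All intro!: eq_matI)
  moreover have "?x \<in> Rel_mats R d e C A u"
    unfolding Rel_mats_def mats_iff
  proof (intro CollectI conjI allI impI ballI)
    fix c assume c: "c \<in> C"
    have "(\<Oplus>z\<in>A c. u $$ z \<otimes> ?x $$ z) = relation c X"
      unfolding relation_def
    proof (intro finsum_cong' refl)
      fix z assume z: "z \<in> A c"
      have "fst z < d" "snd z < e" using cell[OF c z] by simp_all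
      then have "?x $$ z = X (fst z, d + snd z)" by (cases z) simp
      then show "u $$ z \<otimes> ?x $$ z = u $$ z \<otimes> X (fst z, d + snd z)" by simp
    qed (use cl u_closed[OF c] in simp)
    then show "(\<Oplus>z\<in>A c. u $$ z \<otimes> ?x $$ z) = \<zero>" using rel[OF c] by simp
  qed (use cl in simp_all)
  moreover have "mat (d + e) (d + e) X = four_block_mat ?a ?x (transpose_mat ?x) ?b"
  proof (rule eq_matI)
    fix i j assume "i < dim_row (four_block_mat ?a ?x (transpose_mat ?x) ?b)"
      "j < dim_col (four_block_mat ?a ?x (transpose_mat ?x) ?b)"
    then have ij: "i < d + e" "j < d + e" by simp_all
    then have "four_block_mat ?a ?x (transpose_mat ?x) ?b $$ (i, j) = (if i < d then if j < d then X (i, j) else ?x $$ (i, j - d)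
        else if j < d then ?x $$ (j, i - d) else ?b $$ (i - d, j - d))"
      by (subst index_mat_four_block) simp_all
    also have "\<dots> = X (i, j)" using ij sym[of i j] by simp
    finally show "mat (d + e) (d + e) X $$ (i, j) = four_block_mat ?a ?x (transpose_mat ?x) ?b $$ (i, j)"
      using ij by simp
  qed simp_all
  ultimately show ?thesis unfolding SRel_mats_def by blast
qed

lemma SRel_mats_eq: "SRel_mats R d e C A u = mat (d + e) (d + e) ` {X. srel X}"
proof (intro equalityI subsetI)
  fix a assume "a \<in> SRel_mats R d e C A u"
  then show "a \<in> mat (d + e) (d + e) ` {X. srel X}"
    unfolding SRel_mats_def by (blast elim: srel_of_four_block)
qed (use four_block_of_srel in blast)

text \<open>
  For \<open>n = 0\<close> the quotient is the zero ring, in which zero is a unit, so not every lift of a unit is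
  a unit.
\<close>

lemma unit_lift:
  assumes "x \<in> carrier (quot n)"
  obtains a where "a \<in> carrier R" "x = proj n a" "x \<in> Units (quot n) \<Longrightarrow> a \<in> Units R"
proof (cases "n = 0")
  case True
  obtain b where b: "b \<in> carrier R" "x = proj n b" using assms unfolding carrier_quot by blast
  have "b \<ominus> \<one> \<in> ideal_power R P n" unfolding True ideal_power_0 using b(1) by simp
  then have "x = proj n \<one>" unfolding b(2) using proj_eq_iff[OF b(1) one_closed] by blast
  then show ?thesis by (rule that[OF one_closed _ Units_one_closed])
next
  case False
  interpret h: ring_hom_cring R "quot n" "proj n" by (rule proj_hom)
  obtain a where a: "a \<in> carrier R" "x = proj n a" using assms unfolding carrier_quot by blast
  have "a \<in> Units R" if x: "x \<in> Units (quot n)"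
  proof (rule ccontr)
    assume "a \<notin> Units R"
    then have aP: "a \<in> P" using a(1) nonunit_in_maximal_ideal by blast
    obtain x' where x': "x' \<in> carrier (quot n)" "x \<otimes>\<^bsub>quot n\<^esub> x' = \<one>\<^bsub>quot n\<^esub>"
      using h.S.Units_r_inv_ex[OF x] by blast
    obtain b where b: "b \<in> carrier R" "x' = proj n b" using x'(1) unfolding carrier_quot by blast
    have "proj n \<one> = proj n (a \<otimes> b)" using x'(2) a b by simp
    then have "\<one> \<ominus> a \<otimes> b \<in> ideal_power R P n" using proj_eq_iff[of \<one> "a \<otimes> b" n] a(1) b(1) by simp
    moreover have "ideal_power R P n \<subseteq> P"
    proof
      fix z assume "z \<in> ideal_power R P n"
      then obtain c where c: "c \<in> carrier R" "z = p [^] n \<otimes> c" unfolding ideal_power_iff by blast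
      obtain k where n: "n = Suc k" using False by (cases n) simp_all
      have "z = p \<otimes> (p [^] k \<otimes> c)" unfolding c(2) n using c(1) by (simp add: m_assoc m_lcomm)
      moreover have "p [^] k \<otimes> c \<in> carrier R" using c(1) by simp
      ultimately show "z \<in> P" unfolding P_eq cgenideal_iff[OF p_closed] by (rule bexI)
    qed
    ultimately have 1: "\<one> \<ominus> a \<otimes> b \<in> P" by blast
    have 2: "a \<otimes> b \<in> P" using ideal.I_r_closed[OF P_ideal aP b(1)] .
    have "(\<one> \<ominus> a \<otimes> b) \<oplus> a \<otimes> b = \<one>" using a(1) b(1) by (simp add: a_minus_def a_assoc l_neg)
    then have "\<one> \<in> P" using P_add[OF 1 2] by simp
    then show False using unit_notin_maximal_ideal[OF Units_one_closed] by blast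
  qed
  with a show ?thesis by (rule that)
qed

section \<open>Reduction modulo P^n\<close>

lemma row_mult_proj:
  assumes y: "\<And>i. y i \<in> carrier R" and X: "\<And>z. X z \<in> carrier R"
  shows "row_mult (quot n) (vec (d + e) (\<lambda>i. proj n (y i))) (map_mat (proj n) (mat (d + e) (d + e) X))
    = vec (d + e) (\<lambda>j. proj n (act y X j))"
proof (rule eq_vecI)
  interpret h: ring_hom_cring R "quot n" "proj n" by (rule proj_hom)
  let ?a = "map_mat (proj n) (mat (d + e) (d + e) X)" and ?y = "vec (d + e) (\<lambda>i. proj n (y i))"
  show "dim_vec (row_mult (quot n) ?y ?a) = dim_vec (vec (d + e) (\<lambda>j. proj n (act y X j)))" by simp
  fix j assume "j < dim_vec (vec (d + e) (\<lambda>j. proj n (act y X j)))"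
  then have j: "j < d + e" by simp
  have "row_mult (quot n) ?y ?a $ j = finsum (quot n) (\<lambda>i. ?y $ i \<otimes>\<^bsub>quot n\<^esub> ?a $$ (i, j)) {..<d + e}"
    using j by (subst h.S.row_mult_index) simp_all
  also have "\<dots> = finsum (quot n) (\<lambda>i. proj n (y i \<otimes> X (i, j))) {..<d + e}"
    using y X j by (intro h.S.finsum_cong') simp_all
  also have "\<dots> = proj n (act y X j)"
    unfolding act_def using y X by (subst h.hom_finsum) (simp_all add: comp_def)
  finally show "row_mult (quot n) ?y ?a $ j = vec (d + e) (\<lambda>j. proj n (act y X j)) $ j" using j by simp
qed

text \<open>Lifts y and v to \<open>R\<close>, solves the equation modulo P^n there, and projects
  back. The unit entry of y has to lift to a unit of \<open>R\<close>; \<open>unit_lift\<close>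
  arranges this for n = 0 too.\<close>

lemma reduce_SRel_onto:
  assumes y: "y \<in> vecs (carrier (quot n)) (d + e)" "\<exists>i<d + e. y $ i \<in> Units (quot n)"
    and v: "v \<in> vecs (carrier (quot n)) (d + e)"
  shows "\<exists>a\<in>reduce_mats R (ideal_power R P n) (SRel_mats R d e C A u). row_mult (quot n) y a = v"
proof -
  have "\<exists>b. b \<in> carrier R \<and> (i < d + e \<longrightarrow> y $ i = proj n b \<and> (y $ i \<in> Units (quot n) \<longrightarrow> b \<in> Units R))" for i
  proof (cases "i < d + e")
    case True
    then have "y $ i \<in> carrier (quot n)" using y(1) unfolding vecs_iff by blast
    then show ?thesis by (rule unit_lift) blast
  qed (use zero_closed in blast)
  then have "\<exists>w. \<forall>i. w i \<in> carrier R \<and> (i < d + e \<longrightarrow> y $ i = proj n (w i) \<and> (y $ i \<in> Units (quot n) \<longrightarrow> w i \<in> Units R))"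
    by (intro choice allI)
  then obtain w where w: "\<And>i. w i \<in> carrier R" "\<And>i. i < d + e \<Longrightarrow> y $ i = proj n (w i)"
      "\<And>i. i < d + e \<Longrightarrow> y $ i \<in> Units (quot n) \<Longrightarrow> w i \<in> Units R" by blast
  have "\<exists>b. b \<in> carrier R \<and> (i < d + e \<longrightarrow> v $ i = proj n b)" for i
    using v zero_closed unfolding vecs_iff carrier_quot by (cases "i < d + e") blast+
  then have "\<exists>f. \<forall>i. f i \<in> carrier R \<and> (i < d + e \<longrightarrow> v $ i = proj n (f i))"
    by (intro choice allI)
  then obtain f where f: "\<And>i. f i \<in> carrier R" "\<And>i. i < d + e \<Longrightarrow> v $ i = proj n (f i)" by blast
  obtain k where k: "k < d + e" "w k \<in> Units R" using y(2) w(3) by blast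
  obtain X where X: "srel X" "\<And>j. j < d + e \<Longrightarrow> f j \<ominus> act w X j \<in> ideal_power R P n"
    using act_onto_mod_power[of w k f n, OF w(1) k f(1)] by blast
  have cl: "\<And>z. X z \<in> carrier R" using X(1) unfolding srel_def by blast
  have "y = vec (d + e) (\<lambda>i. proj n (w i))" using y(1) w(2) by (intro eq_vecI) (simp_all add: vecs_iff)
  then have "row_mult (quot n) y (map_mat (proj n) (mat (d + e) (d + e) X)) = vec (d + e) (\<lambda>j. proj n (act w X j))"
    using row_mult_proj[of w X n] w(1) cl by simp
  also have "\<dots> = v"
  proof (rule eq_vecI)
    fix j assume "j < dim_vec v"
    then have j: "j < d + e" using v unfolding vecs_iff by simp
    have "proj n (f j) = proj n (act w X j)" using X(2)[OF j] f(1) w(1) cl by (simp add: proj_eq_iff)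
    then show "vec (d + e) (\<lambda>j. proj n (act w X j)) $ j = v $ j" using j f(2) by simp
  qed (use v in \<open>simp add: vecs_iff\<close>)
  finally show ?thesis unfolding reduce_mats_def SRel_mats_eq using X(1) by blast
qed

lemma reduce_SRel_eq:
  "reduce_mats R (ideal_power R P n) (SRel_mats R d e C A u)
    = (\<lambda>X. map_mat (proj n) (mat (d + e) (d + e) X)) ` {X. srel X}"
  unfolding reduce_mats_def SRel_mats_eq image_image ..

lemma ask_reduce_SRel:
  assumes fin: "finite (carrier (R Quot P))" and pos: "d + e > 0"
  shows "ask (quot n) (reduce_mats R (ideal_power R P n) (SRel_mats R d e C A u))
    = 1 + of_nat n * (1 - 1 / of_nat (card (carrier (R Quot P))) ^ (d + e))"
proof -
  interpret h: ring_hom_cring R "quot n" "proj n" by (rule proj_hom)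
  interpret S: finite_chain_ring "quot n" "proj n p" n "card (carrier (R Quot P))"
    using fin by (rule finite_chain_ring_quot)
  let ?M = "reduce_mats R (ideal_power R P n) (SRel_mats R d e C A u)"
  let ?r = "\<lambda>X. map_mat (proj n) (mat (d + e) (d + e) X)"
  have comb: "\<exists>Z. srel Z \<and> mat_sum (quot n) (?r X) (?r Y) = ?r Z"
       "\<exists>Z. srel Z \<and> mat_diff (quot n) (?r X) (?r Y) = ?r Z" if XY: "srel X" "srel Y" for X Y
  proof -
    have cl: "\<And>z. X z \<in> carrier R" "\<And>z. Y z \<in> carrier R" using XY unfolding srel_def by blast+
    have "mat_sum (quot n) (?r X) (?r Y) = ?r (\<lambda>z. X z \<oplus> \<one> \<otimes> Y z)"
      using cl by (intro eq_matI) (simp_all add: mat_sum_def)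
    then show "\<exists>Z. srel Z \<and> mat_sum (quot n) (?r X) (?r Y) = ?r Z"
      using srel_lincomb[OF XY one_closed] by blast
    have "mat_diff (quot n) (?r X) (?r Y) = ?r (\<lambda>z. X z \<oplus> \<ominus> \<one> \<otimes> Y z)"
      using cl by (intro eq_matI) (simp_all add: mat_diff_def a_minus_def h.S.l_minus)
    then show "\<exists>Z. srel Z \<and> mat_diff (quot n) (?r X) (?r Y) = ?r Z"
      using srel_lincomb[OF XY a_inv_closed[OF one_closed]] by blast
  qed
  interpret primitively_surjective "quot n" "proj n p" n "card (carrier (R Quot P))" "d + e" ?M
  proof unfold_locales
    show "d + e > 0" by (rule pos)
    show "?M \<subseteq> mats (quot n) (d + e) (d + e)"
      unfolding reduce_SRel_eq
      by (intro image_subsetI) (simp add: mats_iff srel_def)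
    show "?M \<noteq> {}" unfolding reduce_SRel_eq using srel_zero by blast
    show "mat_sum (quot n) a b \<in> ?M" if "a \<in> ?M" "b \<in> ?M" for a b
      using that comb(1) unfolding reduce_SRel_eq by blast
    show "mat_diff (quot n) a b \<in> ?M" if "a \<in> ?M" "b \<in> ?M" for a b
      using that comb(2) unfolding reduce_SRel_eq by blast
  qed (rule reduce_SRel_onto)
  show ?thesis by (rule ask_eq)
qed

end

text \<open>Each factor 1 - X takes differences of the coefficients: first 1, 1 - c, 1 - c, ...,
  then 1, -c, 0, 0, .... It is applied with c = q^(-(d+e)).\<close>

lemma fps_arith_progression:
  fixes c :: "'a :: field"
  shows "Abs_fps (\<lambda>n. 1 + of_nat n * (1 - c)) = (1 - fps_const c * fps_X) / (1 - fps_X) ^ 2"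
proof -
  let ?F = "Abs_fps (\<lambda>n. 1 + of_nat n * (1 - c))"
  have 1: "?F * (1 - fps_X) = Abs_fps (\<lambda>n. if n = 0 then 1 else 1 - c)" (is "_ = ?G")
  proof (rule fps_ext)
    fix n
    have "fps_nth (?F * (1 - fps_X)) n = fps_nth ?F n - fps_nth (?F * fps_X) n"
      by (simp only: right_diff_distrib mult_1_right fps_sub_nth)
    also have "\<dots> = fps_nth ?G n" by (cases n) (simp_all add: fps_X_mult_right_nth algebra_simps)
    finally show "fps_nth (?F * (1 - fps_X)) n = fps_nth ?G n" .
  qed
  have 2: "?G * (1 - fps_X) = 1 - fps_const c * fps_X"
  proof (rule fps_ext)
    fix n
    have "fps_nth (?G * (1 - fps_X)) n = fps_nth ?G n - fps_nth (?G * fps_X) n"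
      by (simp only: right_diff_distrib mult_1_right fps_sub_nth)
    also have "\<dots> = fps_nth (1 - fps_const c * fps_X) n"
      by (cases n) (simp_all add: fps_X_mult_right_nth)
    finally show "fps_nth (?G * (1 - fps_X)) n = fps_nth (1 - fps_const c * fps_X) n" .
  qed
  have eq: "?F * (1 - fps_X) ^ 2 = 1 - fps_const c * fps_X"
    unfolding power2_eq_square mult.assoc[symmetric] 1 2 ..
  have "fps_nth (1 - fps_X :: 'a fps) 0 \<noteq> 0" by simp
  then have "(1 - fps_X :: 'a fps) \<noteq> 0" by (metis fps_zero_nth)
  then have "(1 - fps_X :: 'a fps) ^ 2 \<noteq> 0" by (rule power_not_zero)
  then show ?thesis unfolding eq[symmetric] by (rule nonzero_mult_div_cancel_right[symmetric])
qed

theorem corollaryD: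
  fixes R :: "('a, 'b) ring_scheme" and P :: "'a set" and q d e :: nat
    and C :: "'c set" and A :: "'c \<Rightarrow> (nat \<times> nat) set" and u :: "'a mat"
  assumes "compact_discrete_valuation_ring R P"
    and "q = card (carrier (R Quot P))"
    and "d \<ge> 1" and "e \<ge> 1"
    and "partial_colouring d e C A"
    and "u \<in> carrier_mat d e" and "elements_mat u \<subseteq> Units R"
    and "admissible d e C A"
  shows "ask_zeta R P (SRel_mats R d e C A u) =
    (1 - fps_const (of_nat q powi (- int d - int e)) * fps_X) / (1 - fps_X) ^ 2"
proof -
  interpret compact_discrete_valuation_ring R P by fact
  obtain p where "uniformized_dvr R P p" using uniformizer_exists by blast
  then interpret uniformized_dvr R P p .
  interpret admissible_relations R P p d e C A u by unfold_locales (rule assms(5-8))+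
  have "(- int d - int e) = - int (d + e)" by simp
  then have q: "(of_nat q :: rat) powi (- int d - int e) = 1 / of_nat q ^ (d + e)"
    by (simp only: power_int_minus power_int_of_nat inverse_eq_divide)
  have "ask_zeta R P (SRel_mats R d e C A u) = Abs_fps (\<lambda>n. 1 + of_nat n * (1 - 1 / of_nat q ^ (d + e)))"
    unfolding ask_zeta_def using ask_reduce_SRel[OF finite_residue] assms(2,3) by simp
  then show ?thesis unfolding q fps_arith_progression .
qed

end
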